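(* Let $f:\mathbb{R}^n\times\mathbb{R}^m\to\mathbb{R}$, $\phi:\mathbb{R}^n\to\mathbb{R}^{p_1+p_2}$, $\varphi:\mathbb{R}^n\times\mathbb{R}^m\to\mathbb{R}^{q}$, $q=q_1+q_2$, be smooth (continuously differentiable), $C=\mathbb{R}^{p_1}_-\times\{0\}^{p_2}$, $D=\mathbb{R}^{q_1}_-\times\{0\}^{q_2}$, $X=\{x\mid\phi(x)\in C\}$, $Y(x)=\{y\mid\varphi(x,y)\in D\}$, and let $(\bar x,\bar y)$ be a calm local minimax point of $\min_{x\in X}\max_{y\in Y(x)}f(x,y)$. Suppose that MSCQ holds for the system $\phi(x)\in C$ at $\bar x$ and that one of the following holds: (i) MFCQ holds for the system $\varphi(\bar x,y)\in D$ at $\bar y$; (ii) RCRCQ holds for $Y$ at $(\bar x,\bar y)$; (iii) $\varphi(x,y)=a(x)+By+c$, where $a:\mathbb{R}^n\to\mathbb{R}^q$ is continuous, $B\in\mathbb{R}^{q\times m}$, $c\in\mathbb{R}^q$, and $Y(x)$ is nonempty for $x$ near $\bar x$. Then there exist $\alpha=(\alpha_1,\alpha_2)\in\mathbb{R}^{p_1}_+\times\mathbb{R}^{p_2}$ and $\beta=(\beta_1,\beta_2)\in\mathbb{R}^{q_1}_+\times\mathbb{R}^{q_2}$ such that $\alpha_1\perp\phi_\le(\bar x)$, $\beta_1\perp\varphi_\le(\bar x,\bar y)$ and $$\nabla_{(x,y)}L(\bar x,\bar y,\alpha,\beta)=0.$$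
   Context: Standing assumptions: $X$ is nonempty; for each $x\in X$, $Y(x)$ is nonempty and the solution set of $\max_{y'\in Y(x)}f(x,y')$ is nonempty. $\mathbb{B}_r(z)$ is the closed Euclidean ball. Components $1,\dots,q_1$ of $\varphi$ (resp. $1,\dots,p_1$ of $\phi$) are the inequality constraints, the remaining ones the equality constraints; $\varphi_\le,\phi_\le$ denote the vectors of inequality components. $L(x,y,\alpha,\beta)=f(x,y)+\phi(x)^T\alpha-\varphi(x,y)^T\beta$. Calm local minimax point: $(\bar x,\bar y)\in X\times Y(\bar x)$ such that there exist $\delta_0>0$ and $\tau:\mathbb{R}_+\to\mathbb{R}_+$ with $\tau(\delta)\to0$ as $\delta\downarrow0$, $\tau(\delta)\le\kappa\delta$ for some $\kappa>0$, and for any $\delta\in(0,\delta_0]$, $x\in X\cap\mathbb{B}_\delta(\bar x)$, $y\in Y(\bar x)\cap\mathbb{B}_\delta(\bar y)$: $f(\bar x,y)\le f(\bar x,\bar y)\le\max_{y'\in Y(x)\cap\mathbb{B}_{\tau(\delta)}(\bar y)}f(x,y')$. (Standing assumption: for the $\tau$ considered, $Y(x)\cap\mathbb{B}_{\tau(\delta)}(\bar y)\neq\emptyset$ for all small $\delta>0$ and $x\in X\cap\mathbb{B}_\delta(\bar x)$.) MSCQ for $\phi(x)\in C$ at $\bar x$: there are a neighborhood $U$ of $\bar x$ and $\rho>0$ with $\operatorname{dist}(x,X)\le\rho\operatorname{dist}(\phi(x),C)$ for all $x\in U$. MFCQ for $\varphi(\bar x,y)\in D$ at $\bar y$: the gradients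 $\nabla_y\varphi_j(\bar x,\bar y)$ of the equality constraints are linearly independent and there is $w\in\mathbb{R}^m$ with $\nabla_y\varphi_j(\bar x,\bar y)^Tw=0$ for all equality constraints and $\nabla_y\varphi_i(\bar x,\bar y)^Tw<0$ for all $i\in I(\bar x,\bar y):=\{i\le q_1\mid\varphi_i(\bar x,\bar y)=0\}$. RCRCQ at $(\bar x,\bar y)$: with $I_0$ the index set of equality constraints, for any $K\subseteq I(\bar x,\bar y)$, $\operatorname{rank}\{\nabla_y\varphi_i(x,y):i\in I_0\cup K\}=\operatorname{rank}\{\nabla_y\varphi_i(\bar x,\bar y):i\in I_0\cup K\}$ for all $(x,y)$ in a neighborhood of $(\bar x,\bar y)$. *)

theory Defs
  imports "HOL-Analysis.Analysis"
begin

text \<open>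
  Constraint mappings with values in a Euclidean space of dimension \<open>k + l\<close> are functions into
  \<open>nat \<Rightarrow> real\<close> of which only the coordinates \<open>i < k + l\<close> matter; in this way \<open>k = 0\<close> and
  \<open>l = 0\<close> (no inequalities, no equalities) are allowed. Coordinates are counted from \<open>0\<close>: the
  inequalities are \<open>i < k\<close>, the equalities \<open>k \<le> i < k + l\<close>.
\<close>

definition gradient :: "('a::real_inner \<Rightarrow> real) \<Rightarrow> 'a \<Rightarrow> 'a" where
  "gradient f z = (THE D. GDERIV f z :> D)"

lemma gradient_eqI:
  assumes "GDERIV f z :> D"
  shows "gradient f z = D"
  unfolding gradient_def
proof (rule the_equality)
  show "GDERIV f z :> D" by (rule assms)
next
  fix D' assume "GDERIV f z :> D'"
  with assms have "(\<lambda>h. inner h D') = (\<lambda>h. inner h D)"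
    unfolding gderiv_def by (metis has_derivative_unique)
  then have "inner (D' - D) D' = inner (D' - D) D" by metis
  then have "inner (D' - D) (D' - D) = 0" by (simp add: inner_diff_right)
  then show "D' = D" by simp
qed

definition cont_differentiable :: "('a::real_inner \<Rightarrow> real) \<Rightarrow> bool" where
  "cont_differentiable f \<longleftrightarrow>
     (\<exists>g. (\<forall>z. GDERIV f z :> g z) \<and> continuous_on UNIV g)"

definition constraint_cone :: "nat \<Rightarrow> nat \<Rightarrow> (nat \<Rightarrow> real) set" where
  "constraint_cone k l = {z. (\<forall>i<k. z i \<le> 0) \<and> (\<forall>i\<in>{k..<k+l}. z i = 0)}"

text \<open>Euclidean distance from a point to a set, in the first \<open>N\<close> coordinates.\<close>

definition coord_dist :: "nat \<Rightarrow> (nat \<Rightarrow> real) \<Rightarrow> (nat \<Rightarrow> real) set \<Rightarrow> real" where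
  "coord_dist N z S = (INF c\<in>S. L2_set (\<lambda>i. z i - c i) {..<N})"

definition feasible_x :: "('x \<Rightarrow> nat \<Rightarrow> real) \<Rightarrow> nat \<Rightarrow> nat \<Rightarrow> 'x set" where
  "feasible_x \<phi> p1 p2 = {x. \<phi> x \<in> constraint_cone p1 p2}"

definition feasible_y :: "('x \<times> 'y \<Rightarrow> nat \<Rightarrow> real) \<Rightarrow> nat \<Rightarrow> nat \<Rightarrow> 'x \<Rightarrow> 'y set" where
  "feasible_y \<psi> q1 q2 x = {y. \<psi> (x, y) \<in> constraint_cone q1 q2}"

text \<open>
  The inequality \<open>f (xb, yb) \<le> max {f (x, y') | y'. \<dots>}\<close> is expressed through a maximizer \<open>ym\<close>.
  In particular the set over which the maximum is taken is nonempty.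
\<close>

definition calm_local_minimax ::
  "('x::euclidean_space \<times> 'y::euclidean_space \<Rightarrow> real) \<Rightarrow> 'x set \<Rightarrow> ('x \<Rightarrow> 'y set)
     \<Rightarrow> 'x \<Rightarrow> 'y \<Rightarrow> bool" where
  "calm_local_minimax f X Y xb yb \<longleftrightarrow>
     xb \<in> X \<and> yb \<in> Y xb \<and>
     (\<exists>\<delta>0>0. \<exists>\<tau>::real \<Rightarrow> real.
        (\<forall>\<delta>\<ge>0. \<tau> \<delta> \<ge> 0) \<and>
        (\<tau> \<longlongrightarrow> 0) (at_right 0) \<and>
        (\<exists>\<kappa>>0. \<forall>\<delta>\<in>{0<..\<delta>0}. \<tau> \<delta> \<le> \<kappa> * \<delta>) \<and>
        (\<forall>\<delta>\<in>{0<..\<delta>0}. \<forall>x\<in>X \<inter> cball xb \<delta>. \<forall>y\<in>Y xb \<inter> cball yb \<delta>.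
           f (xb, y) \<le> f (xb, yb) \<and>
           (\<exists>ym. is_arg_max (\<lambda>y'. f (x, y')) (\<lambda>y'. y' \<in> Y x \<inter> cball yb (\<tau> \<delta>)) ym \<and>
                 f (xb, yb) \<le> f (x, ym))))"

definition MSCQ :: "('x::euclidean_space \<Rightarrow> nat \<Rightarrow> real) \<Rightarrow> nat \<Rightarrow> nat \<Rightarrow> 'x \<Rightarrow> bool" where
  "MSCQ \<phi> p1 p2 xb \<longleftrightarrow>
     (\<exists>U \<rho>. open U \<and> xb \<in> U \<and> \<rho> > 0 \<and>
        (\<forall>x\<in>U. infdist x (feasible_x \<phi> p1 p2)
                 \<le> \<rho> * coord_dist (p1 + p2) (\<phi> x) (constraint_cone p1 p2)))"

definition grad_y ::
  "('x \<times> 'y::euclidean_space \<Rightarrow> nat \<Rightarrow> real) \<Rightarrow> nat \<Rightarrow> 'x \<times> 'y \<Rightarrow> 'y" where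
  "grad_y \<psi> i z = gradient (\<lambda>y. \<psi> (fst z, y) i) (snd z)"

definition active_ineq :: "('x \<times> 'y \<Rightarrow> nat \<Rightarrow> real) \<Rightarrow> nat \<Rightarrow> 'x \<times> 'y \<Rightarrow> nat set" where
  "active_ineq \<psi> q1 z = {i. i < q1 \<and> \<psi> z i = 0}"

text \<open>
  Linear independence in \<open>MFCQ\<close> is that of an indexed family, hence \<open>inj_on\<close>. The rank of a
  family of vectors in \<open>RCRCQ\<close> is the dimension of its span.
\<close>

definition MFCQ ::
  "('x::euclidean_space \<times> 'y::euclidean_space \<Rightarrow> nat \<Rightarrow> real) \<Rightarrow> nat \<Rightarrow> nat \<Rightarrow> 'x \<Rightarrow> 'y \<Rightarrow> bool"
where
  "MFCQ \<psi> q1 q2 xb yb \<longleftrightarrow>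
     inj_on (\<lambda>j. grad_y \<psi> j (xb, yb)) {q1..<q1+q2} \<and>
     independent ((\<lambda>j. grad_y \<psi> j (xb, yb)) ` {q1..<q1+q2}) \<and>
     (\<exists>w. (\<forall>j\<in>{q1..<q1+q2}. inner (grad_y \<psi> j (xb, yb)) w = 0) \<and>
          (\<forall>i\<in>active_ineq \<psi> q1 (xb, yb). inner (grad_y \<psi> i (xb, yb)) w < 0))"

definition RCRCQ ::
  "('x::euclidean_space \<times> 'y::euclidean_space \<Rightarrow> nat \<Rightarrow> real) \<Rightarrow> nat \<Rightarrow> nat \<Rightarrow> 'x \<Rightarrow> 'y \<Rightarrow> bool"
where
  "RCRCQ \<psi> q1 q2 xb yb \<longleftrightarrow>
     (\<forall>K \<subseteq> active_ineq \<psi> q1 (xb, yb). \<forall>\<^sub>F z in nhds (xb, yb).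
        dim ((\<lambda>i. grad_y \<psi> i z) ` ({q1..<q1+q2} \<union> K)) =
        dim ((\<lambda>i. grad_y \<psi> i (xb, yb)) ` ({q1..<q1+q2} \<union> K)))"

definition lagrangian ::
  "('x \<times> 'y \<Rightarrow> real) \<Rightarrow> ('x \<Rightarrow> nat \<Rightarrow> real) \<Rightarrow> nat \<Rightarrow> ('x \<times> 'y \<Rightarrow> nat \<Rightarrow> real) \<Rightarrow> nat
     \<Rightarrow> 'x \<Rightarrow> 'y \<Rightarrow> (nat \<Rightarrow> real) \<Rightarrow> (nat \<Rightarrow> real) \<Rightarrow> real" where
  "lagrangian f \<phi> p \<psi> q x y \<alpha> \<beta> =
     f (x, y) + (\<Sum>i<p. \<phi> x i * \<alpha> i) - (\<Sum>i<q. \<psi> (x, y) i * \<beta> i)"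

end

theory Submission
  imports Defs
begin

text \<open>
  The inner multiplier \<open>\<beta>\<close> can be fixed first. For fixed \<open>xb\<close>, the point \<open>yb\<close> is a local maximizer of
  \<open>f (xb, \<cdot>)\<close> over \<open>Y xb\<close>, and each of the three conditions on the inner constraints yields
  \<open>\<beta>\<close> with \<open>\<nabla>\<^sub>y f = \<Sum> \<beta>\<^sub>i \<nabla>\<^sub>y \<psi>\<^sub>i\<close> (\<open>lower_level_KKT\<close>); the affine case is an instance of constant rank.

  Now let \<open>u\<close> be a direction of the linearized cone of \<open>X\<close> at \<open>xb\<close>. Metric subregularity makes \<open>u\<close> tangent
  to \<open>X\<close> (\<open>MSCQ_tangent_sequence\<close>), and calmness lets the inner responses to this motion be
  differentiated along a subsequence (\<open>calm_minimax_ascent_direction\<close>): there is \<open>v\<close> such that \<open>(u, v)\<close>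
  satisfies the linearized inner constraints and \<open>\<nabla>\<^sub>x f \<bullet> u + \<nabla>\<^sub>y f \<bullet> v \<ge> 0\<close>. Substituting the formula
  for \<open>\<nabla>\<^sub>y f\<close> and using \<open>\<beta>\<^sub>i (\<nabla>\<^sub>x \<psi>\<^sub>i \<bullet> u + \<nabla>\<^sub>y \<psi>\<^sub>i \<bullet> v) \<le> 0\<close> eliminates \<open>v\<close>:
  \<open>(\<nabla>\<^sub>x f - \<Sum> \<beta>\<^sub>i \<nabla>\<^sub>x \<psi>\<^sub>i) \<bullet> u \<ge> 0\<close> for all such \<open>u\<close>. Farkas' lemma turns this into the outer multiplier \<open>\<alpha>\<close>.
  The elimination is weak duality, so one and the same \<open>\<beta>\<close> serves all directions \<open>u\<close>.

  The inner multiplier rule is obtained from the exterior penalty method: stationary points of the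
  penalized problems give multipliers that represent \<open>\<nabla>\<^sub>y f\<close> up to an error tending to \<open>0\<close>
  (\<open>approximate_KKT\<close>). Under the Mangasarian-Fromovitz condition these multipliers are bounded; under
  constant rank they become bounded after a Caratheodory reduction to independent gradients
  (\<open>KKT_constant_rank\<close>). Farkas' lemma is the special case of linear data.
\<close>

section \<open>Representations with bounded multipliers\<close>

text \<open>
  A family is linearly independent, repetitions counted as dependencies, exactly when its rank is the
  size of its index set. This is the bridge between the ranks in the constant rank condition and
  statements about coefficients.
\<close>
lemma dim_image_eq_card_iff:
  fixes v :: "'i \<Rightarrow> 'a::euclidean_space"
  assumes "finite I"
  shows "dim (v ` I) = card I \<longleftrightarrow>
    (\<forall>c. (\<Sum>i\<in>I. c i *\<^sub>R v i) = 0 \<longrightarrow> (\<forall>i\<in>I. c i = 0))"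
proof
  assume dim: "dim (v ` I) = card I"
  have "dim (v ` I) \<le> card (v ` I)"
    using assms by (intro dim_le_card' finite_imageI)
  then have card: "card (v ` I) = card I"
    using dim card_image_le[OF assms, of v] by (simp only: le_antisym)
  then have inj: "inj_on v I"
    by (rule eq_card_imp_inj_on[OF assms])
  have ind: "independent (v ` I)"
    by (rule card_le_dim_spanning[of _ "v ` I"]) (use assms card dim in \<open>auto intro: span_base\<close>)
  show "\<forall>c. (\<Sum>i\<in>I. c i *\<^sub>R v i) = 0 \<longrightarrow> (\<forall>i\<in>I. c i = 0)"
  proof (intro allI impI ballI)
    fix c i assume c: "(\<Sum>i\<in>I. c i *\<^sub>R v i) = 0" and i: "i \<in> I"
    have "(\<Sum>x\<in>v ` I. c (the_inv_into I v x) *\<^sub>R x) = (\<Sum>i\<in>I. c i *\<^sub>R v i)"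
      using inj by (simp add: sum.reindex the_inv_into_f_f)
    then have "c (the_inv_into I v (v i)) = 0"
      using independentD[OF ind, of "v ` I" "\<lambda>x. c (the_inv_into I v x)" "v i"] assms c i by auto
    then show "c i = 0" using inj i by (simp add: the_inv_into_f_f)
  qed
next
  assume indep: "\<forall>c. (\<Sum>i\<in>I. c i *\<^sub>R v i) = 0 \<longrightarrow> (\<forall>i\<in>I. c i = 0)"
  have inj: "inj_on v I"
  proof (rule inj_onI, rule ccontr)
    fix i j assume ij: "i \<in> I" "j \<in> I" "v i = v j" "i \<noteq> j"
    have "(\<Sum>l\<in>I. ((if l = i then 1 else 0) - (if l = j then 1 else 0)) *\<^sub>R v l) = 0"
      using ij assms
      by (simp add: scaleR_left_diff_distrib sum_subtractf if_distrib[of "\<lambda>a. a *\<^sub>R _"] sum.delta cong: if_cong)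
    from indep[rule_format, OF this ij(1)] show False using ij by simp
  qed
  have "independent (v ` I)"
  proof (rule independent_if_scalars_zero)
    fix f x assume f: "(\<Sum>x\<in>v ` I. f x *\<^sub>R x) = 0" and x: "x \<in> v ` I"
    have "(\<Sum>i\<in>I. f (v i) *\<^sub>R v i) = 0"
      using f inj by (simp add: sum.reindex)
    from indep[rule_format, OF this] x show "f x = 0" by auto
  qed (use assms in auto)
  then show "dim (v ` I) = card I"
    using inj by (simp add: dim_eq_card_independent card_image)
qed

lemma finite_family_convergent_subsequence:
  fixes b :: "nat \<Rightarrow> 'i \<Rightarrow> real"
  assumes "finite I" and "\<And>k i. i \<in> I \<Longrightarrow> \<bar>b k i\<bar> \<le> M"
  shows "\<exists>l r. strict_mono r \<and> (\<forall>i\<in>I. (\<lambda>k. b (r k) i) \<longlonglongrightarrow> l i)"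
  using assms
proof (induction I)
  case empty
  show ?case by (auto intro: exI[of _ id] simp: strict_mono_id)
next
  case (insert j I)
  then obtain l r where lr: "strict_mono r" "\<forall>i\<in>I. (\<lambda>k. b (r k) i) \<longlonglongrightarrow> l i"
    by fastforce
  have "\<forall>k. b (r k) j \<in> {-M..M}"
    using insert.prems[of j] by (auto simp: abs_le_iff minus_le_iff)
  then obtain a s where s: "strict_mono s" "((\<lambda>k. b (r k) j) \<circ> s) \<longlonglongrightarrow> a"
    using compact_Icc[of "-M" M] unfolding compact_def by metis
  have "(\<lambda>k. b (r (s k)) i) \<longlonglongrightarrow> (l(j := a)) i" if "i \<in> insert j I" for i
  proof (cases "i = j")
    case True
    then show ?thesis using s by (simp add: o_def)
  next
    case False
    then have "(\<lambda>k. b (r k) i) \<longlonglongrightarrow> l i" using lr that by auto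
    from LIMSEQ_subseq_LIMSEQ[OF this s(1)] show ?thesis using False by (simp add: o_def)
  qed
  moreover have "strict_mono (\<lambda>k. r (s k))"
    using lr(1) s(1) by (simp add: strict_mono_def)
  ultimately show ?case
    by (intro exI[of _ "l(j := a)"] exI[of _ "\<lambda>k. r (s k)"] conjI ballI)
qed

text \<open>
  A family is positively independent if a linear combination whose coefficients are nonnegative on
  \<open>A\<close> vanishes only trivially. Both sides of the inequality are positively homogeneous in \<open>c\<close>, so a
  failure for every \<open>m\<close> yields coefficients of absolute sum \<open>1\<close> whose combinations tend to \<open>0\<close>; a limit
  point of these coefficients is a nontrivial vanishing combination.
\<close>
lemma multiplier_bound:
  fixes v :: "'i \<Rightarrow> 'a::euclidean_space"
  assumes fin: "finite I" and "A \<subseteq> I"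
    and pos: "\<And>c. \<forall>i\<in>A. 0 \<le> c i \<Longrightarrow> (\<Sum>i\<in>I. c i *\<^sub>R v i) = 0 \<Longrightarrow> \<forall>i\<in>I. c i = 0"
  shows "\<exists>m>0. \<forall>c. (\<forall>i\<in>A. 0 \<le> c i) \<longrightarrow>
           m * (\<Sum>i\<in>I. \<bar>c i\<bar>) \<le> norm (\<Sum>i\<in>I. c i *\<^sub>R v i)"
proof (rule ccontr)
  assume neg: "\<not> ?thesis"
  have "\<exists>d. (\<forall>i\<in>A. 0 \<le> d i) \<and> (\<Sum>i\<in>I. \<bar>d i\<bar>) = 1 \<and>
          norm (\<Sum>i\<in>I. d i *\<^sub>R v i) < inverse (real (Suc k))" for k
  proof -
    have "\<not> (\<forall>c. (\<forall>i\<in>A. 0 \<le> c i) \<longrightarrow>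
        inverse (real (Suc k)) * (\<Sum>i\<in>I. \<bar>c i\<bar>) \<le> norm (\<Sum>i\<in>I. c i *\<^sub>R v i))"
      using neg positive_imp_inverse_positive[of "real (Suc k)"] of_nat_0_less_iff zero_less_Suc by blast
    then obtain c where c: "\<forall>i\<in>A. 0 \<le> c i"
      and less: "norm (\<Sum>i\<in>I. c i *\<^sub>R v i) < inverse (real (Suc k)) * (\<Sum>i\<in>I. \<bar>c i\<bar>)"
      unfolding not_all not_imp not_le by blast
    define S where "S = (\<Sum>i\<in>I. \<bar>c i\<bar>)"
    have "S \<noteq> 0" using less unfolding S_def by auto
    moreover have "S \<ge> 0" unfolding S_def by (simp add: sum_nonneg)
    ultimately have S: "S > 0" by simp
    have "(\<Sum>i\<in>I. (c i / S) *\<^sub>R v i) = (1 / S) *\<^sub>R (\<Sum>i\<in>I. c i *\<^sub>R v i)"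
      by (simp add: scaleR_sum_right)
    then have "norm (\<Sum>i\<in>I. (c i / S) *\<^sub>R v i) < inverse (real (Suc k))"
      using less S by (simp add: S_def[symmetric] pos_divide_less_eq)
    moreover have "(\<Sum>i\<in>I. \<bar>c i / S\<bar>) = 1"
      using S by (simp add: sum_divide_distrib[symmetric] S_def[symmetric])
    moreover have "\<forall>i\<in>A. 0 \<le> c i / S" using c S by simp
    ultimately show ?thesis by (intro exI[of _ "\<lambda>i. c i / S"]) simp
  qed
  then obtain d where d: "\<And>k. \<forall>i\<in>A. 0 \<le> d k i" "\<And>k. (\<Sum>i\<in>I. \<bar>d k i\<bar>) = 1"
    "\<And>k. norm (\<Sum>i\<in>I. d k i *\<^sub>R v i) < inverse (real (Suc k))"
    by metis
  have "\<bar>d k i\<bar> \<le> 1" if "i \<in> I" for k i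
    using member_le_sum[OF that, of "\<lambda>i. \<bar>d k i\<bar>"] fin d(2)[of k] by simp
  then obtain l r where r: "strict_mono r" and l: "\<And>i. i \<in> I \<Longrightarrow> (\<lambda>k. d (r k) i) \<longlonglongrightarrow> l i"
    using finite_family_convergent_subsequence[OF fin, of d 1] by blast
  have "(\<lambda>k. \<Sum>i\<in>I. d (r k) i *\<^sub>R v i) \<longlonglongrightarrow> (\<Sum>i\<in>I. l i *\<^sub>R v i)"
    by (intro tendsto_intros l)
  moreover have "(\<lambda>k. \<Sum>i\<in>I. d k i *\<^sub>R v i) \<longlonglongrightarrow> 0"
    by (rule Lim_null_comparison[OF _ LIMSEQ_inverse_real_of_nat])
       (use d(3) in \<open>auto intro!: always_eventually less_imp_le\<close>)
  from LIMSEQ_subseq_LIMSEQ[OF this r]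
  have "(\<lambda>k. \<Sum>i\<in>I. d (r k) i *\<^sub>R v i) \<longlonglongrightarrow> 0" by (simp add: o_def)
  ultimately have "(\<Sum>i\<in>I. l i *\<^sub>R v i) = 0" by (rule LIMSEQ_unique)
  moreover have "\<forall>i\<in>A. 0 \<le> l i"
  proof
    fix i assume "i \<in> A"
    with \<open>A \<subseteq> I\<close> have "(\<lambda>k. d (r k) i) \<longlonglongrightarrow> l i" by (blast intro: l)
    then show "0 \<le> l i" by (rule LIMSEQ_le_const) (use d(1) \<open>i \<in> A\<close> in blast)
  qed
  ultimately have "\<forall>i\<in>I. l i = 0" using pos by blast
  then have "(\<Sum>i\<in>I. \<bar>l i\<bar>) = 0" by simp
  moreover have "(\<lambda>k. \<Sum>i\<in>I. \<bar>d (r k) i\<bar>) \<longlonglongrightarrow> (\<Sum>i\<in>I. \<bar>l i\<bar>)"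
    by (intro tendsto_intros l)
  ultimately have "(\<lambda>k::nat. 1::real) \<longlonglongrightarrow> 0" unfolding d(2) by (simp only:)
  then show False using LIMSEQ_unique[OF tendsto_const[of "1::real"]] by (metis zero_neq_one)
qed

text \<open>
  Moving each vector by at most \<open>m / 2\<close> changes a combination by at most \<open>m / 2\<close> times the absolute sum
  of its coefficients, so half of the constant survives.
\<close>
lemma multiplier_bound_stable:
  fixes v :: "'i \<Rightarrow> 'a::euclidean_space"
  assumes fin: "finite I" and "A \<subseteq> I"
    and pos: "\<And>c. \<forall>i\<in>A. 0 \<le> c i \<Longrightarrow> (\<Sum>i\<in>I. c i *\<^sub>R v i) = 0 \<Longrightarrow> \<forall>i\<in>I. c i = 0"
    and lim: "\<And>i. i \<in> I \<Longrightarrow> (\<lambda>k. w k i) \<longlonglongrightarrow> v i"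
  shows "\<exists>m>0. \<forall>\<^sub>F k in sequentially. \<forall>c. (\<forall>i\<in>A. 0 \<le> c i) \<longrightarrow>
           m * (\<Sum>i\<in>I. \<bar>c i\<bar>) \<le> norm (\<Sum>i\<in>I. c i *\<^sub>R w k i)"
proof -
  obtain m where m: "m > 0" and bd: "\<And>c. \<forall>i\<in>A. 0 \<le> c i \<Longrightarrow>
      m * (\<Sum>i\<in>I. \<bar>c i\<bar>) \<le> norm (\<Sum>i\<in>I. c i *\<^sub>R v i)"
    using multiplier_bound[OF fin \<open>A \<subseteq> I\<close>, of v] pos by blast
  have "\<forall>\<^sub>F k in sequentially. \<forall>i\<in>I. dist (w k i) (v i) < m / 2"
    using fin lim m by (intro eventually_ball_finite ballI tendstoD) simp_all
  then have "\<forall>\<^sub>F k in sequentially. \<forall>c. (\<forall>i\<in>A. 0 \<le> c i) \<longrightarrow>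
           m / 2 * (\<Sum>i\<in>I. \<bar>c i\<bar>) \<le> norm (\<Sum>i\<in>I. c i *\<^sub>R w k i)"
  proof (rule eventually_mono, intro allI impI)
    fix k and c :: "'i \<Rightarrow> real" assume close: "\<forall>i\<in>I. dist (w k i) (v i) < m / 2" and c: "\<forall>i\<in>A. 0 \<le> c i"
    have "norm ((\<Sum>i\<in>I. c i *\<^sub>R v i) - (\<Sum>i\<in>I. c i *\<^sub>R w k i))
        = norm (\<Sum>i\<in>I. c i *\<^sub>R (v i - w k i))"
      by (simp add: sum_subtractf scaleR_right_diff_distrib)
    also have "\<dots> \<le> (\<Sum>i\<in>I. \<bar>c i\<bar> * (m / 2))"
    proof (rule sum_norm_le)
      fix i assume "i \<in> I"
      then have "norm (v i - w k i) \<le> m / 2"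
        using close by (metis dist_norm norm_minus_commute less_imp_le)
      then show "norm (c i *\<^sub>R (v i - w k i)) \<le> \<bar>c i\<bar> * (m / 2)"
        unfolding norm_scaleR by (rule mult_left_mono) simp
    qed
    finally have "norm ((\<Sum>i\<in>I. c i *\<^sub>R v i) - (\<Sum>i\<in>I. c i *\<^sub>R w k i)) \<le> (\<Sum>i\<in>I. \<bar>c i\<bar>) * (m / 2)"
      by (simp only: sum_distrib_right)
    moreover have "norm (\<Sum>i\<in>I. c i *\<^sub>R v i) \<le> norm (\<Sum>i\<in>I. c i *\<^sub>R w k i)
        + norm ((\<Sum>i\<in>I. c i *\<^sub>R v i) - (\<Sum>i\<in>I. c i *\<^sub>R w k i))"
      using norm_triangle_sub by blast
    ultimately show "m / 2 * (\<Sum>i\<in>I. \<bar>c i\<bar>) \<le> norm (\<Sum>i\<in>I. c i *\<^sub>R w k i)"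
      using bd[OF c] by (simp add: algebra_simps)
  qed
  then show ?thesis using m by (intro exI[of _ "m / 2"]) auto
qed

text \<open>
  Representations \<open>g = \<Sum> b\<^sub>i v\<^sub>i\<close> survive passage to the limit when the limiting family is
  positively independent: the coefficients then stay bounded, and any limit point of them
  represents the limit.
\<close>
lemma multiplier_limit:
  fixes v :: "'i \<Rightarrow> 'a::euclidean_space"
  assumes fin: "finite I" and "A \<subseteq> I"
    and pos: "\<And>c. \<forall>i\<in>A. 0 \<le> c i \<Longrightarrow> (\<Sum>i\<in>I. c i *\<^sub>R v i) = 0 \<Longrightarrow> \<forall>i\<in>I. c i = 0"
    and lim: "\<And>i. i \<in> I \<Longrightarrow> (\<lambda>k. w k i) \<longlonglongrightarrow> v i"
    and nonneg: "\<And>k i. i \<in> A \<Longrightarrow> 0 \<le> c k i"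
    and g: "(\<lambda>k. \<Sum>i\<in>I. c k i *\<^sub>R w k i) \<longlonglongrightarrow> g"
  shows "\<exists>b. (\<forall>i\<in>A. 0 \<le> b i) \<and> g = (\<Sum>i\<in>I. b i *\<^sub>R v i)"
proof -
  obtain m where m: "m > 0" and bd: "\<forall>\<^sub>F k in sequentially. \<forall>c. (\<forall>i\<in>A. 0 \<le> c i) \<longrightarrow>
           m * (\<Sum>i\<in>I. \<bar>c i\<bar>) \<le> norm (\<Sum>i\<in>I. c i *\<^sub>R w k i)"
    using multiplier_bound_stable[OF fin \<open>A \<subseteq> I\<close>, of v w] pos lim by blast
  have "\<forall>\<^sub>F k in sequentially. norm (\<Sum>i\<in>I. c k i *\<^sub>R w k i) < norm g + 1"
    using tendsto_norm[OF g] by (rule order_tendstoD) simp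
  with bd have "\<forall>\<^sub>F k in sequentially. \<forall>i\<in>I. \<bar>c k i\<bar> \<le> (norm g + 1) / m"
  proof eventually_elim
    case (elim k)
    have "m * (\<Sum>i\<in>I. \<bar>c k i\<bar>) \<le> norm g + 1"
      using elim nonneg by (meson less_imp_le order_trans)
    then have "(\<Sum>i\<in>I. \<bar>c k i\<bar>) \<le> (norm g + 1) / m"
      using m by (simp add: pos_le_divide_eq mult.commute)
    moreover have "\<bar>c k i\<bar> \<le> (\<Sum>i\<in>I. \<bar>c k i\<bar>)" if "i \<in> I" for i
      using fin that by (intro member_le_sum) auto
    ultimately show ?case by (meson order_trans)
  qed
  then obtain N where N: "\<And>k i. k \<ge> N \<Longrightarrow> i \<in> I \<Longrightarrow> \<bar>c k i\<bar> \<le> (norm g + 1) / m"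
    unfolding eventually_sequentially by blast
  then obtain b r where r: "strict_mono r" and b: "\<And>i. i \<in> I \<Longrightarrow> (\<lambda>k. c (r k + N) i) \<longlonglongrightarrow> b i"
    using finite_family_convergent_subsequence[OF fin, of "\<lambda>k. c (k + N)" "(norm g + 1) / m"]
    by fastforce
  have r': "strict_mono (\<lambda>k. r k + N)" using r by (simp add: strict_mono_def)
  have "(\<lambda>k. \<Sum>i\<in>I. c (r k + N) i *\<^sub>R w (r k + N) i) \<longlonglongrightarrow> (\<Sum>i\<in>I. b i *\<^sub>R v i)"
    by (intro tendsto_intros b LIMSEQ_subseq_LIMSEQ[OF lim r', unfolded o_def])
  then have "g = (\<Sum>i\<in>I. b i *\<^sub>R v i)"
    using LIMSEQ_subseq_LIMSEQ[OF g r'] by (auto intro: LIMSEQ_unique simp: o_def)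
  moreover have "\<forall>i\<in>A. 0 \<le> b i"
  proof
    fix i assume "i \<in> A"
    with \<open>A \<subseteq> I\<close> have "(\<lambda>k. c (r k + N) i) \<longlonglongrightarrow> b i" by (blast intro: b)
    then show "0 \<le> b i" by (rule LIMSEQ_le_const) (use nonneg \<open>i \<in> A\<close> in blast)
  qed
  ultimately show ?thesis by blast
qed

lemma dim_image_eq_card_stable:
  fixes v :: "'i \<Rightarrow> 'a::euclidean_space"
  assumes fin: "finite I" and dim: "dim (v ` I) = card I"
    and lim: "\<And>i. i \<in> I \<Longrightarrow> (\<lambda>k. w k i) \<longlonglongrightarrow> v i"
  shows "\<forall>\<^sub>F k in sequentially. dim (w k ` I) = card I"
proof -
  have pos: "\<And>c. (\<Sum>i\<in>I. c i *\<^sub>R v i) = 0 \<Longrightarrow> \<forall>i\<in>I. c i = 0"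
    using dim unfolding dim_image_eq_card_iff[OF fin] by blast
  have "\<exists>m>0. \<forall>\<^sub>F k in sequentially. \<forall>c. (\<forall>i\<in>{}. 0 \<le> c i) \<longrightarrow>
           m * (\<Sum>i\<in>I. \<bar>c i\<bar>) \<le> norm (\<Sum>i\<in>I. c i *\<^sub>R w k i)"
    by (rule multiplier_bound_stable[OF fin empty_subsetI]) (erule pos, erule lim)
  then obtain m where m: "m > 0" and bd: "\<forall>\<^sub>F k in sequentially. \<forall>c. (\<forall>i\<in>{}. 0 \<le> c i) \<longrightarrow>
           m * (\<Sum>i\<in>I. \<bar>c i\<bar>) \<le> norm (\<Sum>i\<in>I. c i *\<^sub>R w k i)"
    by (elim exE conjE)
  from bd show ?thesis
  proof eventually_elim
    case (elim k)
    show ?case unfolding dim_image_eq_card_iff[OF fin]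
    proof (intro allI impI)
      fix c assume "(\<Sum>i\<in>I. c i *\<^sub>R w k i) = 0"
      with elim have "m * (\<Sum>i\<in>I. \<bar>c i\<bar>) \<le> 0" by (metis norm_zero empty_iff)
      then have "(\<Sum>i\<in>I. \<bar>c i\<bar>) \<le> 0" using m by (simp add: mult_le_0_iff)
      then have "(\<Sum>i\<in>I. \<bar>c i\<bar>) = 0" by (meson abs_ge_zero antisym sum_nonneg)
      then show "\<forall>i\<in>I. c i = 0" using fin by (simp add: sum_nonneg_eq_0_iff)
    qed
  qed
qed

text \<open>
  As in Caratheodory's theorem for cones, but the coefficients on \<open>J\<close> have no sign, so only indices in
  \<open>K\<close> may be dropped. Independence of the family over \<open>J\<close> guarantees that every dependency involves an
  index of \<open>K\<close>.
\<close>
lemma conic_caratheodory: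
  fixes v :: "'i \<Rightarrow> 'a::euclidean_space"
  assumes "finite K" and fJ: "finite J" and "J \<inter> K = {}" and J: "dim (v ` J) = card J"
    and "\<forall>i\<in>K. 0 \<le> b i"
  shows "\<exists>K' b'. K' \<subseteq> K \<and> (\<forall>i\<in>K'. 0 \<le> b' i) \<and> dim (v ` (J \<union> K')) = card (J \<union> K') \<and>
           (\<Sum>i\<in>J \<union> K. b i *\<^sub>R v i) = (\<Sum>i\<in>J \<union> K'. b' i *\<^sub>R v i)"
  using assms(1,3,5)
proof (induction K arbitrary: b rule: finite_psubset_induct)
  case (psubset K)
  have fin: "finite (J \<union> K)" using psubset fJ by simp
  show ?case
  proof (cases "dim (v ` (J \<union> K)) = card (J \<union> K)")
    case True
    then show ?thesis using psubset.prems by blast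
  next
    case False
    then obtain c0 j where c0: "(\<Sum>i\<in>J \<union> K. c0 i *\<^sub>R v i) = 0" "j \<in> J \<union> K" "c0 j \<noteq> 0"
      unfolding dim_image_eq_card_iff[OF fin] by blast
    have "\<exists>i\<in>K. c0 i \<noteq> 0"
    proof (rule ccontr)
      assume no: "\<not> ?thesis"
      have "(\<Sum>i\<in>J \<union> K. c0 i *\<^sub>R v i) = (\<Sum>i\<in>J. c0 i *\<^sub>R v i)"
        by (rule sum.mono_neutral_right) (use no fin in auto)
      then have "\<forall>i\<in>J. c0 i = 0"
        using J c0(1) unfolding dim_image_eq_card_iff[OF fJ] by simp
      then show False using no c0 by auto
    qed
    then obtain p where p: "p \<in> K" "c0 p \<noteq> 0" by blast
    \<comment> \<open>With the sign of the dependency chosen so that some coefficient on \<open>K\<close> is positive, subtract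
      the largest multiple \<open>t\<close> of it that keeps the coefficients on \<open>K\<close> nonnegative.\<close>
    define c where "c = (\<lambda>i. sgn (c0 p) * c0 i)"
    have c: "(\<Sum>i\<in>J \<union> K. c i *\<^sub>R v i) = 0"
      using c0(1) by (simp add: c_def scaleR_sum_right[symmetric] scaleR_scaleR[symmetric] del: scaleR_scaleR)
    have cp: "c p > 0" using p by (simp add: c_def sgn_if)
    define P where "P = {i\<in>K. c i > 0}"
    have P: "finite P" "P \<noteq> {}" using psubset p cp by (auto simp: P_def)
    define t where "t = Min ((\<lambda>i. b i / c i) ` P)"
    have "t \<in> (\<lambda>i. b i / c i) ` P" unfolding t_def using P by (intro Min_in) auto
    then obtain q where q: "q \<in> P" "t = b q / c q" by blast
    have t: "t \<le> b i / c i" if "i \<in> P" for i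
      unfolding t_def using P that by (intro Min_le) auto
    have t0: "t \<ge> 0" using q psubset.prems by (auto simp: P_def)
    define b1 where "b1 = (\<lambda>i. b i - t * c i)"
    have b1: "0 \<le> b1 i" if "i \<in> K" for i
    proof (cases "c i > 0")
      case True
      then show ?thesis using t[of i] that by (simp add: b1_def P_def pos_le_divide_eq)
    next
      case False
      then have "t * c i \<le> 0" using t0 by (simp add: mult_nonneg_nonpos)
      moreover have "0 \<le> b i" using psubset.prems(2) that by blast
      ultimately show ?thesis by (simp add: b1_def)
    qed
    have bq: "b1 q = 0" and qK: "q \<in> K" using q by (auto simp: b1_def P_def)
    have "(\<Sum>i\<in>J \<union> K. b i *\<^sub>R v i) = (\<Sum>i\<in>J \<union> K. b1 i *\<^sub>R v i)"
      using c by (simp add: b1_def scaleR_left_diff_distrib sum_subtractf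
          scaleR_sum_right[symmetric] scaleR_scaleR[symmetric] del: scaleR_scaleR)
    also have "\<dots> = (\<Sum>i\<in>J \<union> (K - {q}). b1 i *\<^sub>R v i)"
      by (rule sum.mono_neutral_right) (use fin bq in auto)
    finally have eq: "(\<Sum>i\<in>J \<union> K. b i *\<^sub>R v i) = (\<Sum>i\<in>J \<union> (K - {q}). b1 i *\<^sub>R v i)" .
    have "K - {q} \<subset> K" "J \<inter> (K - {q}) = {}" "\<forall>i\<in>K - {q}. 0 \<le> b1 i"
      using qK b1 psubset.prems by auto
    from psubset.IH[OF this] obtain K' b' where "K' \<subseteq> K - {q}" "\<forall>i\<in>K'. 0 \<le> b' i"
      "dim (v ` (J \<union> K')) = card (J \<union> K')"
      "(\<Sum>i\<in>J \<union> (K - {q}). b1 i *\<^sub>R v i) = (\<Sum>i\<in>J \<union> K'. b' i *\<^sub>R v i)" by blast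
    then show ?thesis using eq by (intro exI[of _ K'] exI[of _ b']) auto
  qed
qed

section \<open>Approximate stationarity by penalization\<close>

lemma has_real_derivative_max_0_square:
  "((\<lambda>t::real. (max 0 t)\<^sup>2) has_real_derivative 2 * max 0 t) (at t)"
proof (cases t "0::real" rule: linorder_cases)
  case less
  have "((\<lambda>t::real. 0) has_real_derivative 2 * max 0 t) (at t)" using less by simp
  then show ?thesis
    by (rule has_field_derivative_transform_within_open[where S="{..<0}"]) (use less in auto)
next
  case equal
  have "((\<lambda>h. ((max 0 (t + h))\<^sup>2 - (max 0 t)\<^sup>2) / h) \<longlongrightarrow> 0) (at 0)"
  proof (rule Lim_null_comparison)
    show "\<forall>\<^sub>F h in at 0. norm (((max 0 (t + h))\<^sup>2 - (max 0 t)\<^sup>2) / h) \<le> \<bar>h\<bar>"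
      by (intro always_eventually allI) (auto simp: equal max_def power2_eq_square)
    show "((\<lambda>h::real. \<bar>h\<bar>) \<longlongrightarrow> 0) (at 0)"
      by (rule tendsto_eq_intros | simp)+
  qed
  then show ?thesis unfolding DERIV_def using equal by simp
next
  case greater
  have "((\<lambda>t::real. t\<^sup>2) has_real_derivative 2 * max 0 t) (at t)"
    using greater by (auto intro!: derivative_eq_intros)
  then show ?thesis
    by (rule has_field_derivative_transform_within_open[where S="{0<..}"]) (use greater in auto)
qed

text \<open>
  The exterior penalty method. Let \<open>P\<close> be the sum of the squared constraint violations. On the compact
  ball \<open>cball yb d\<close>, choose a maximizer \<open>y\<^sub>k\<close> of \<open>h y - norm (y - yb)^2 - k * P y\<close>. Comparison with \<open>yb\<close>
  forces \<open>P y\<^sub>k \<rightarrow> 0\<close>, so a limit point is feasible, and there the proximal term makes \<open>yb\<close> the only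
  possible limit. Hence the maximizers are eventually interior, and the vanishing of the gradient
  is the approximate stationarity condition; its multipliers \<open>2 k max 0 (c\<^sub>i y\<^sub>k)\<close> and
  \<open>2 k c\<^sub>i y\<^sub>k\<close> have the right signs, but they may be unbounded.
\<close>
lemma approximate_KKT:
  fixes h :: "'a::euclidean_space \<Rightarrow> real" and c :: "'i \<Rightarrow> 'a \<Rightarrow> real"
  assumes fin: "finite A" "finite E" and disj: "A \<inter> E = {}"
    and h': "\<And>y. GDERIV h y :> h' y" and h'_cont: "isCont h' yb"
    and c': "\<And>i y. i \<in> A \<union> E \<Longrightarrow> GDERIV (c i) y :> c' i y"
    and feas: "\<And>i. i \<in> A \<Longrightarrow> c i yb \<le> 0" "\<And>i. i \<in> E \<Longrightarrow> c i yb = 0"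
    and d: "0 < d"
    and max: "\<And>y. y \<in> cball yb d \<Longrightarrow> \<forall>i\<in>A. c i y \<le> 0 \<Longrightarrow> \<forall>i\<in>E. c i y = 0 \<Longrightarrow> h y \<le> h yb"
    and A0: "A0 = {i\<in>A. c i yb = 0}"
  shows "\<exists>y b. y \<longlonglongrightarrow> yb \<and> (\<forall>k. \<forall>i\<in>A0. 0 \<le> b k i) \<and>
           (\<lambda>k. \<Sum>i\<in>A0 \<union> E. b k i *\<^sub>R c' i (y k)) \<longlonglongrightarrow> h' yb"
proof -
  define P where "P = (\<lambda>y. (\<Sum>i\<in>A. (max 0 (c i y))\<^sup>2) + (\<Sum>i\<in>E. (c i y)\<^sup>2))"
  define H where "H = (\<lambda>(k::nat) y. h y - (y - yb) \<bullet> (y - yb) - real k * P y)"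
  have h_cont: "isCont h y" for y
    using h'[of y] unfolding gderiv_def by (rule has_derivative_continuous)
  have c_cont: "isCont (c i) y" if "i \<in> A \<union> E" for i y
    using c'[OF that, of y] unfolding gderiv_def by (rule has_derivative_continuous)
  have P_cont: "isCont P y" for y
    unfolding P_def by (intro continuous_intros c_cont) auto
  have H_cont: "isCont (H k) y" for k y
    unfolding H_def by (intro continuous_intros h_cont P_cont)
  have P_nonneg: "P y \<ge> 0" for y
    unfolding P_def by (intro add_nonneg_nonneg sum_nonneg) auto
  have P_yb: "P yb = 0"
    using feas by (simp add: P_def max_absorb1)
  have P_0: "(\<forall>i\<in>A. c i y \<le> 0) \<and> (\<forall>i\<in>E. c i y = 0)" if "P y = 0" for y
  proof -
    have "(\<Sum>i\<in>A. (max 0 (c i y))\<^sup>2) = 0" "(\<Sum>i\<in>E. (c i y)\<^sup>2) = 0"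
      using that add_nonneg_eq_0_iff[of "\<Sum>i\<in>A. (max 0 (c i y))\<^sup>2" "\<Sum>i\<in>E. (c i y)\<^sup>2"]
      by (auto simp: P_def sum_nonneg)
    then show ?thesis
      using fin by (auto simp: sum_nonneg_eq_0_iff max_def not_le less_imp_le split: if_splits)
  qed
  have ne: "cball yb d \<noteq> {}" using d by auto
  have "\<exists>y\<in>cball yb d. \<forall>z\<in>cball yb d. H k z \<le> H k y" for k
    using H_cont by (intro continuous_attains_sup compact_cball ne continuous_at_imp_continuous_on) auto
  then obtain y where y: "\<And>k. y k \<in> cball yb d" and y_max: "\<And>k z. z \<in> cball yb d \<Longrightarrow> H k z \<le> H k (y k)"
    by metis
  have H_ge: "h yb \<le> H k (y k)" for k
    using y_max[of yb k] d P_yb by (simp add: H_def)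
  obtain M where M: "\<And>z. z \<in> cball yb d \<Longrightarrow> h z \<le> M"
    using continuous_attains_sup[OF compact_cball ne, of h] h_cont continuous_at_imp_continuous_on
    by (metis continuous_at_imp_continuous_on)
  have P_le: "real k * P (y k) \<le> M - h yb" for k
    using H_ge[of k] M[OF y, of k] inner_ge_zero[of "y k - yb"] unfolding H_def by linarith
  obtain ys r where ys: "ys \<in> cball yb d" and r: "strict_mono r" and lim: "(y \<circ> r) \<longlonglongrightarrow> ys"
    using compact_cball[of yb d] y unfolding compact_def by metis
  have lim': "(\<lambda>k. y (r k)) \<longlonglongrightarrow> ys" using lim by (simp add: o_def)
  have "(\<lambda>k. P (y (r k))) \<longlonglongrightarrow> 0"
  proof (rule Lim_null_comparison)
    show "\<forall>\<^sub>F k in sequentially. norm (P (y (r k))) \<le> (M - h yb) * inverse (real k)"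
    proof (rule eventually_mono[OF eventually_gt_at_top[of 0]])
      fix k :: nat assume k: "0 < k"
      have "real k * P (y (r k)) \<le> real (r k) * P (y (r k))"
        using strict_mono_imp_increasing[OF r, of k] P_nonneg by (intro mult_right_mono) auto
      then have "real k * P (y (r k)) \<le> M - h yb" using P_le[of "r k"] by linarith
      then show "norm (P (y (r k))) \<le> (M - h yb) * inverse (real k)"
        using P_nonneg k by (simp add: field_simps)
    qed
    show "(\<lambda>k. (M - h yb) * inverse (real k)) \<longlonglongrightarrow> 0"
      by (rule tendsto_mult_right_zero[OF lim_inverse_n])
  qed
  moreover have "(\<lambda>k. P (y (r k))) \<longlonglongrightarrow> P ys"
    by (rule isCont_tendsto_compose[OF P_cont lim'])
  ultimately have "P ys = 0" using LIMSEQ_unique by blast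
  then have "h ys \<le> h yb" using max[OF ys] P_0 by blast
  moreover have "h yb \<le> h ys - (ys - yb) \<bullet> (ys - yb)"
  proof (rule LIMSEQ_le_const)
    show "(\<lambda>k. h (y (r k)) - (y (r k) - yb) \<bullet> (y (r k) - yb)) \<longlonglongrightarrow> h ys - (ys - yb) \<bullet> (ys - yb)"
      by (intro tendsto_intros isCont_tendsto_compose[OF h_cont] lim')
    have "h yb \<le> h (y k) - (y k - yb) \<bullet> (y k - yb)" for k
      using H_ge[of k] mult_nonneg_nonneg[OF of_nat_0_le_iff P_nonneg, of k "y k"] unfolding H_def by linarith
    then show "\<exists>N. \<forall>k\<ge>N. h yb \<le> h (y (r k)) - (y (r k) - yb) \<bullet> (y (r k) - yb)" by blast
  qed
  ultimately have "(ys - yb) \<bullet> (ys - yb) \<le> 0" by linarith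
  then have "ys = yb" by (metis inner_gt_zero_iff not_le right_minus_eq)
  with lim' have lim: "(\<lambda>k. y (r k)) \<longlonglongrightarrow> yb" by simp
  have "\<forall>\<^sub>F k in sequentially. dist (y (r k)) yb < d"
    using lim d by (rule tendstoD)
  moreover have "\<forall>\<^sub>F k in sequentially. \<forall>i\<in>{i\<in>A. c i yb < 0}. c i (y (r k)) < 0"
    using fin c_cont by (intro eventually_ball_finite ballI order_tendstoD(2)[OF isCont_tendsto_compose[OF _ lim]]) auto
  ultimately have "\<forall>\<^sub>F k in sequentially. dist (y (r k)) yb < d \<and> (\<forall>i\<in>{i\<in>A. c i yb < 0}. c i (y (r k)) < 0)"
    by eventually_elim simp
  then obtain N where N: "\<And>k. k \<ge> N \<Longrightarrow> dist (y (r k)) yb < d"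
    "\<And>k i. k \<ge> N \<Longrightarrow> i \<in> A \<Longrightarrow> c i yb < 0 \<Longrightarrow> c i (y (r k)) < 0"
    unfolding eventually_sequentially by auto
  \<comment> \<open>From index \<open>N\<close> on, the maximizers are interior and the inactive constraints stay strict, so
    their multipliers vanish.\<close>
  define z where "z = (\<lambda>k. y (r (k + N)))"
  define b where "b = (\<lambda>k i. 2 * real (r (k + N)) * (if i \<in> A then max 0 (c i (z k)) else c i (z k)))"
  have z: "z \<longlonglongrightarrow> yb" unfolding z_def using LIMSEQ_ignore_initial_segment[OF lim] .
  have stationary: "(\<Sum>i\<in>A \<union> E. b k i *\<^sub>R c' i (z k)) = h' (z k) - 2 *\<^sub>R (z k - yb)" for k
  proof -
    define K where "K = r (k + N)"
    let ?D = "\<lambda>v. v \<bullet> h' (z k) - (2 * (v \<bullet> (z k - yb))) - real K *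
       ((\<Sum>i\<in>A. 2 * max 0 (c i (z k)) * (v \<bullet> c' i (z k))) + (\<Sum>i\<in>E. 2 * c i (z k) * (v \<bullet> c' i (z k))))"
    have cd: "(c i has_derivative (\<lambda>v. v \<bullet> c' i (z k))) (at (z k))" if "i \<in> A \<union> E" for i
      using c'[OF that] unfolding gderiv_def .
    have "((\<lambda>y. (max 0 (c i y))\<^sup>2) has_derivative (\<lambda>v. 2 * max 0 (c i (z k)) * (v \<bullet> c' i (z k)))) (at (z k))"
      if "i \<in> A" for i
      using has_derivative_compose[OF cd has_real_derivative_max_0_square[unfolded has_field_derivative_def]] that
      by simp
    moreover have "((\<lambda>y. (c i y)\<^sup>2) has_derivative (\<lambda>v. 2 * c i (z k) * (v \<bullet> c' i (z k)))) (at (z k))"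
      if "i \<in> E" for i
      using cd[of i] that by (auto intro!: derivative_eq_intros simp: fun_eq_iff)
    ultimately have "(P has_derivative (\<lambda>v. (\<Sum>i\<in>A. 2 * max 0 (c i (z k)) * (v \<bullet> c' i (z k)))
        + (\<Sum>i\<in>E. 2 * c i (z k) * (v \<bullet> c' i (z k))))) (at (z k))"
      unfolding P_def by (intro has_derivative_add has_derivative_sum)
    moreover have "((\<lambda>y. (y - yb) \<bullet> (y - yb)) has_derivative (\<lambda>v. 2 * (v \<bullet> (z k - yb)))) (at (z k))"
      by (auto intro!: derivative_eq_intros simp: fun_eq_iff inner_commute)
    ultimately have "(H K has_derivative ?D) (at (z k))"
      unfolding H_def using h'[of "z k"] unfolding gderiv_def
      by (intro has_derivative_diff has_derivative_mult_right)
    moreover have "z k \<in> ball yb d" using N(1)[of "k + N"] by (simp add: z_def dist_commute)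
    moreover have "\<forall>y\<in>ball yb d. H K y \<le> H K (z k)"
      using y_max[of _ K] by (auto simp: z_def K_def)
    ultimately have D0: "?D = (\<lambda>v. 0)"
      by (intro differential_zero_maxmin[of "z k" "ball yb d" "H K"]) auto
    have "v \<bullet> (h' (z k) - 2 *\<^sub>R (z k - yb) - (\<Sum>i\<in>A \<union> E. b k i *\<^sub>R c' i (z k))) = ?D v" for v
    proof -
      have "v \<bullet> (\<Sum>i\<in>A \<union> E. b k i *\<^sub>R c' i (z k))
          = (\<Sum>i\<in>A. b k i * (v \<bullet> c' i (z k))) + (\<Sum>i\<in>E. b k i * (v \<bullet> c' i (z k)))"
        using fin disj by (simp add: inner_sum_right inner_add_right sum.union_disjoint)
      also have "(\<Sum>i\<in>A. b k i * (v \<bullet> c' i (z k)))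
          = real K * (\<Sum>i\<in>A. 2 * max 0 (c i (z k)) * (v \<bullet> c' i (z k)))"
        unfolding sum_distrib_left by (intro sum.cong) (auto simp: b_def K_def)
      also have "(\<Sum>i\<in>E. b k i * (v \<bullet> c' i (z k)))
          = real K * (\<Sum>i\<in>E. 2 * c i (z k) * (v \<bullet> c' i (z k)))"
        unfolding sum_distrib_left using disj by (intro sum.cong) (auto simp: b_def K_def)
      finally have "v \<bullet> (\<Sum>i\<in>A \<union> E. b k i *\<^sub>R c' i (z k)) = real K *
          ((\<Sum>i\<in>A. 2 * max 0 (c i (z k)) * (v \<bullet> c' i (z k)))
            + (\<Sum>i\<in>E. 2 * c i (z k) * (v \<bullet> c' i (z k))))"
        by (simp only: distrib_left)
      then show ?thesis by (simp add: inner_diff_right)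
    qed
    then have "v \<bullet> (h' (z k) - 2 *\<^sub>R (z k - yb) - (\<Sum>i\<in>A \<union> E. b k i *\<^sub>R c' i (z k))) = 0" for v
      using D0 by (metis (no_types, lifting))
    then have "h' (z k) - 2 *\<^sub>R (z k - yb) - (\<Sum>i\<in>A \<union> E. b k i *\<^sub>R c' i (z k)) = 0"
      by (metis inner_eq_zero_iff)
    then show ?thesis by simp
  qed
  have "(\<lambda>k. h' (z k) - 2 *\<^sub>R (z k - yb)) \<longlonglongrightarrow> h' yb - 2 *\<^sub>R (yb - yb)"
    by (intro tendsto_intros isCont_tendsto_compose[OF h'_cont] z)
  then have lim: "(\<lambda>k. \<Sum>i\<in>A \<union> E. b k i *\<^sub>R c' i (z k)) \<longlonglongrightarrow> h' yb"
    unfolding stationary by simp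
  have "(\<Sum>i\<in>A \<union> E. b k i *\<^sub>R c' i (z k)) = (\<Sum>i\<in>A0 \<union> E. b k i *\<^sub>R c' i (z k))" for k
  proof (rule sum.mono_neutral_right)
    show "\<forall>i\<in>(A \<union> E) - (A0 \<union> E). b k i *\<^sub>R c' i (z k) = 0"
    proof
      fix i assume "i \<in> (A \<union> E) - (A0 \<union> E)"
      then have i: "i \<in> A" "c i yb < 0" using feas(1)[of i] by (auto simp: A0)
      then have "c i (z k) < 0" unfolding z_def by (intro N(2)) auto
      then show "b k i *\<^sub>R c' i (z k) = 0" using i by (simp add: b_def)
    qed
  qed (use fin in \<open>auto simp: A0\<close>)
  with lim have "(\<lambda>k. \<Sum>i\<in>A0 \<union> E. b k i *\<^sub>R c' i (z k)) \<longlonglongrightarrow> h' yb" by simp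
  moreover have "\<forall>k. \<forall>i\<in>A0. 0 \<le> b k i" by (simp add: b_def A0)
  ultimately show ?thesis using z by blast
qed

section \<open>Multiplier rules and the lemma of Farkas\<close>

text \<open>
  Positive independence of the active gradients, the dual form of the Mangasarian-Fromovitz
  condition, bounds the approximate multipliers.
\<close>
lemma KKT_positively_independent:
  fixes h :: "'a::euclidean_space \<Rightarrow> real" and c :: "'i \<Rightarrow> 'a \<Rightarrow> real"
  assumes fin: "finite A" "finite E" and disj: "A \<inter> E = {}"
    and h': "\<And>y. GDERIV h y :> h' y" and h'_cont: "isCont h' yb"
    and c': "\<And>i y. i \<in> A \<union> E \<Longrightarrow> GDERIV (c i) y :> c' i y"
    and c'_cont: "\<And>i. i \<in> A \<union> E \<Longrightarrow> isCont (c' i) yb"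
    and feas: "\<And>i. i \<in> A \<Longrightarrow> c i yb \<le> 0" "\<And>i. i \<in> E \<Longrightarrow> c i yb = 0"
    and d: "0 < d"
    and max: "\<And>y. y \<in> cball yb d \<Longrightarrow> \<forall>i\<in>A. c i y \<le> 0 \<Longrightarrow> \<forall>i\<in>E. c i y = 0 \<Longrightarrow> h y \<le> h yb"
    and A0: "A0 = {i\<in>A. c i yb = 0}"
    and pos: "\<And>b. \<forall>i\<in>A0. 0 \<le> b i \<Longrightarrow> (\<Sum>i\<in>A0 \<union> E. b i *\<^sub>R c' i yb) = 0 \<Longrightarrow> \<forall>i\<in>A0 \<union> E. b i = 0"
  shows "\<exists>b. (\<forall>i\<in>A0. 0 \<le> b i) \<and> h' yb = (\<Sum>i\<in>A0 \<union> E. b i *\<^sub>R c' i yb)"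
proof -
  have "\<exists>y b. y \<longlonglongrightarrow> yb \<and> (\<forall>k. \<forall>i\<in>A0. 0 \<le> b k i) \<and>
           (\<lambda>k. \<Sum>i\<in>A0 \<union> E. b k i *\<^sub>R c' i (y k)) \<longlonglongrightarrow> h' yb"
    by (rule approximate_KKT[where h=h and d=d and A=A]) fact+
  then obtain y b where y: "y \<longlonglongrightarrow> yb" and b: "\<forall>k. \<forall>i\<in>A0. 0 \<le> b k i"
    and lim: "(\<lambda>k. \<Sum>i\<in>A0 \<union> E. b k i *\<^sub>R c' i (y k)) \<longlonglongrightarrow> h' yb"
    by (elim exE conjE)
  show ?thesis
  proof (rule multiplier_limit[OF _ _ pos _ _ lim])
    show "(\<lambda>k. c' i (y k)) \<longlonglongrightarrow> c' i yb" if "i \<in> A0 \<union> E" for i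
      by (rule isCont_tendsto_compose[OF c'_cont y]) (use that in \<open>auto simp: A0\<close>)
  qed (use fin b in \<open>auto simp: A0\<close>)
qed

text \<open>
  Pairing a vanishing combination with the direction \<open>w\<close> leaves a sum of nonpositive terms, strictly
  negative wherever an inequality has a positive coefficient. So these coefficients vanish, and
  the equality gradients are independent.
\<close>
lemma positively_independent_of_MFCQ:
  fixes v :: "'i \<Rightarrow> 'a::euclidean_space"
  assumes fin: "finite A" "finite E" and disj: "A \<inter> E = {}"
    and E: "dim (v ` E) = card E"
    and w: "\<And>i. i \<in> E \<Longrightarrow> v i \<bullet> w = 0" "\<And>i. i \<in> A \<Longrightarrow> v i \<bullet> w < 0"
    and b: "\<forall>i\<in>A. 0 \<le> b i" and zero: "(\<Sum>i\<in>A \<union> E. b i *\<^sub>R v i) = 0"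
  shows "\<forall>i\<in>A \<union> E. b i = 0"
proof -
  have "0 = (\<Sum>i\<in>A \<union> E. b i *\<^sub>R v i) \<bullet> w" using zero by simp
  also have "\<dots> = (\<Sum>i\<in>A. b i * (v i \<bullet> w)) + (\<Sum>i\<in>E. b i * (v i \<bullet> w))"
    using fin disj by (simp add: inner_sum_left sum.union_disjoint inner_add_left)
  finally have "(\<Sum>i\<in>A. - (b i * (v i \<bullet> w))) = 0" using w(1) by (simp add: sum_negf)
  then have "\<forall>i\<in>A. - (b i * (v i \<bullet> w)) = 0"
    by (subst (asm) sum_nonneg_eq_0_iff) (use fin b w(2) in \<open>auto intro: mult_nonneg_nonpos less_imp_le\<close>)
  then have A: "\<forall>i\<in>A. b i = 0" using w(2) by force
  then have "(\<Sum>i\<in>E. b i *\<^sub>R v i) = 0"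
    using zero fin disj by (simp add: sum.union_disjoint)
  then show ?thesis using A E unfolding dim_image_eq_card_iff[OF fin(2)] by blast
qed

text \<open>
  Approximate multipliers need not be bounded here, so the representation is changed before passing
  to the limit. Choose \<open>J \<subseteq> E\<close> whose gradients form a basis of the span of all equality gradients at
  \<open>yb\<close>. They stay independent nearby, and since the rank of \<open>E\<close> does not grow, they still span the
  equality gradients. Caratheodory's theorem then selects active inequalities \<open>K\<close> such that the
  gradients over \<open>J \<union> K\<close> are independent at \<open>y\<^sub>k\<close>; one \<open>K\<close> occurs for infinitely many \<open>k\<close>. The constant
  rank of \<open>E \<union> K\<close> transports this independence to \<open>yb\<close>, and the new multipliers converge along a
  subsequence.
\<close>
lemma KKT_constant_rank:
  fixes h :: "'a::euclidean_space \<Rightarrow> real" and c :: "'i \<Rightarrow> 'a \<Rightarrow> real"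
  assumes fin: "finite A" "finite E" and disj: "A \<inter> E = {}"
    and h': "\<And>y. GDERIV h y :> h' y" and h'_cont: "isCont h' yb"
    and c': "\<And>i y. i \<in> A \<union> E \<Longrightarrow> GDERIV (c i) y :> c' i y"
    and c'_cont: "\<And>i. i \<in> A \<union> E \<Longrightarrow> isCont (c' i) yb"
    and feas: "\<And>i. i \<in> A \<Longrightarrow> c i yb \<le> 0" "\<And>i. i \<in> E \<Longrightarrow> c i yb = 0"
    and d: "0 < d"
    and max: "\<And>y. y \<in> cball yb d \<Longrightarrow> \<forall>i\<in>A. c i y \<le> 0 \<Longrightarrow> \<forall>i\<in>E. c i y = 0 \<Longrightarrow> h y \<le> h yb"
    and A0: "A0 = {i\<in>A. c i yb = 0}"
    and rank: "\<And>K. K \<subseteq> A0 \<Longrightarrow> \<forall>\<^sub>F y in nhds yb.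
      dim ((\<lambda>i. c' i y) ` (E \<union> K)) = dim ((\<lambda>i. c' i yb) ` (E \<union> K))"
  shows "\<exists>b. (\<forall>i\<in>A0. 0 \<le> b i) \<and> h' yb = (\<Sum>i\<in>A0 \<union> E. b i *\<^sub>R c' i yb)"
proof -
  have A0A: "A0 \<subseteq> A" and finA0: "finite A0" using fin by (auto simp: A0)
  have "\<exists>y b. y \<longlonglongrightarrow> yb \<and> (\<forall>k. \<forall>i\<in>A0. 0 \<le> b k i) \<and>
           (\<lambda>k. \<Sum>i\<in>A0 \<union> E. b k i *\<^sub>R c' i (y k)) \<longlonglongrightarrow> h' yb"
    by (rule approximate_KKT[where h=h and d=d and A=A]) fact+
  then obtain y b where y: "y \<longlonglongrightarrow> yb" and b: "\<forall>k. \<forall>i\<in>A0. 0 \<le> b k i"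
    and lim: "(\<lambda>k. \<Sum>i\<in>A0 \<union> E. b k i *\<^sub>R c' i (y k)) \<longlonglongrightarrow> h' yb"
    by (elim exE conjE)
  have c'_lim: "(\<lambda>k. c' i (y k)) \<longlonglongrightarrow> c' i yb" if "i \<in> A0 \<union> E" for i
    by (rule isCont_tendsto_compose[OF c'_cont y]) (use that A0A in auto)
  define v where "v = (\<lambda>k i. c' i (y k))"
  define vb where "vb = (\<lambda>i. c' i yb)"
  obtain B where B: "B \<subseteq> vb ` E" "independent B" "vb ` E \<subseteq> span B" "card B = dim (vb ` E)"
    by (rule basis_exists)
  then obtain J where J: "J \<subseteq> E" "inj_on vb J" "B = vb ` J"
    unfolding subset_image_inj by blast
  have finJ: "finite J" using J fin finite_subset by blast
  have cardJ: "card J = dim (vb ` E)" using B J by (simp add: card_image)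
  have dimJ: "dim (vb ` J) = card J" using B J by (simp add: dim_eq_card_independent card_image)
  have spanJ: "span (vb ` J) = span (vb ` E)"
    using J dimJ cardJ by (intro dim_eq_span image_mono) auto
  have rank': "\<forall>\<^sub>F k in sequentially. \<forall>K\<in>Pow A0. dim (v k ` (E \<union> K)) = dim (vb ` (E \<union> K))"
    unfolding v_def vb_def using finA0 rank y
    by (intro eventually_ball_finite ballI) (auto simp: filterlim_iff)
  have "\<forall>\<^sub>F k in sequentially. dim (v k ` J) = card J"
    by (rule dim_image_eq_card_stable[OF finJ dimJ]) (use c'_lim J in \<open>auto simp: v_def vb_def\<close>)
  with rank' have "\<forall>\<^sub>F k in sequentially. dim (v k ` J) = card J \<and>
      (\<forall>K\<in>Pow A0. dim (v k ` (E \<union> K)) = dim (vb ` (E \<union> K)))"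
    by eventually_elim simp
  then obtain N where N: "\<And>k. k \<ge> N \<Longrightarrow> dim (v k ` J) = card J"
    "\<And>k K. k \<ge> N \<Longrightarrow> K \<subseteq> A0 \<Longrightarrow> dim (v k ` (E \<union> K)) = dim (vb ` (E \<union> K))"
    unfolding eventually_sequentially by auto
  have spanJk: "span (v k ` J) = span (v k ` E)" if "k \<ge> N" for k
    using J N(1)[OF that] N(2)[OF that, of "{}"] cardJ by (intro dim_eq_span image_mono) auto
  define Q where "Q = (\<lambda>k K b'. K \<subseteq> A0 \<and> (\<forall>i\<in>K. 0 \<le> b' i) \<and>
      dim (v k ` (J \<union> K)) = card (J \<union> K) \<and>
      (\<Sum>i\<in>A0 \<union> E. b k i *\<^sub>R v k i) = (\<Sum>i\<in>J \<union> K. b' i *\<^sub>R v k i))"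
  have "\<exists>K b'. Q k K b'" if k: "k \<ge> N" for k
  proof -
    have "(\<Sum>i\<in>E. b k i *\<^sub>R v k i) \<in> span (v k ` J)"
      unfolding spanJk[OF k] by (intro span_sum span_scale span_base) auto
    then obtain u where "(\<Sum>i\<in>E. b k i *\<^sub>R v k i) = (\<Sum>x\<in>v k ` J. u x *\<^sub>R x)"
      using finJ by (auto simp: span_finite)
    moreover have "inj_on (v k) J"
    proof (rule eq_card_imp_inj_on[OF finJ])
      have "card J \<le> card (v k ` J)"
        using dim_le_card'[of "v k ` J"] N(1)[OF k] finJ by simp
      then show "card (v k ` J) = card J" using card_image_le[OF finJ, of "v k"] by simp
    qed
    ultimately have Esum: "(\<Sum>i\<in>E. b k i *\<^sub>R v k i) = (\<Sum>i\<in>J. u (v k i) *\<^sub>R v k i)"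
      by (simp add: sum.reindex)
    define b1 where "b1 = (\<lambda>i. if i \<in> J then u (v k i) else b k i)"
    have JA0: "J \<inter> A0 = {}" using J A0A disj by auto
    have "(\<Sum>i\<in>A0 \<union> E. b k i *\<^sub>R v k i) = (\<Sum>i\<in>A0. b k i *\<^sub>R v k i) + (\<Sum>i\<in>E. b k i *\<^sub>R v k i)"
      using finA0 fin A0A disj by (intro sum.union_disjoint) auto
    also have "\<dots> = (\<Sum>i\<in>A0. b1 i *\<^sub>R v k i) + (\<Sum>i\<in>J. b1 i *\<^sub>R v k i)"
      unfolding Esum using JA0 by (intro arg_cong2[where f=plus] sum.cong) (auto simp: b1_def)
    also have "\<dots> = (\<Sum>i\<in>J \<union> A0. b1 i *\<^sub>R v k i)"
      using finJ finA0 JA0 by (simp add: sum.union_disjoint)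
    finally have eq: "(\<Sum>i\<in>A0 \<union> E. b k i *\<^sub>R v k i) = (\<Sum>i\<in>J \<union> A0. b1 i *\<^sub>R v k i)" .
    have b1: "\<forall>i\<in>A0. 0 \<le> b1 i" using b JA0 A0A by (auto simp: b1_def)
    show ?thesis
      unfolding Q_def eq using conic_caratheodory[OF finA0 finJ JA0 N(1)[OF k] b1] by blast
  qed
  then obtain K b' where Q: "\<And>k. k \<ge> N \<Longrightarrow> Q k (K k) (b' k)" by metis
  then have K: "\<And>k. k \<ge> N \<Longrightarrow> K k \<subseteq> A0" "\<And>k. k \<ge> N \<Longrightarrow> \<forall>i\<in>K k. 0 \<le> b' k i"
    "\<And>k. k \<ge> N \<Longrightarrow> dim (v k ` (J \<union> K k)) = card (J \<union> K k)"
    "\<And>k. k \<ge> N \<Longrightarrow> (\<Sum>i\<in>A0 \<union> E. b k i *\<^sub>R v k i) = (\<Sum>i\<in>J \<union> K k. b' k i *\<^sub>R v k i)"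
    unfolding Q_def by auto
  \<comment> \<open>There are finitely many index sets, so one of them recurs along a subsequence.\<close>
  have "finite (K ` {N..})"
    by (rule finite_subset[of _ "Pow A0"]) (use K finA0 in auto)
  then obtain k0 where k0: "k0 \<in> {N..}" "infinite {k\<in>{N..}. K k = K k0}"
    using pigeonhole_infinite[of "{N..}" K] infinite_Ici by blast
  define K0 where "K0 = K k0"
  obtain r :: "nat \<Rightarrow> nat" where r: "strict_mono r" "\<And>k. r k \<in> {k\<in>{N..}. K k = K0}"
    using infinite_enumerate[OF k0(2)] unfolding K0_def by blast
  have K0: "K0 \<subseteq> A0" using K(1) k0 by (auto simp: K0_def)
  have finJK: "finite (J \<union> K0)" using finJ finA0 K0 finite_subset by blast
  have dimK0: "dim (v k0 ` (J \<union> K0)) = card (J \<union> K0)" using K(3) k0 by (auto simp: K0_def)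
  have span_union: "span (f ` (J \<union> K0)) = span (f ` (E \<union> K0))" if "span (f ` J) = span (f ` E)"
    for f :: "'i \<Rightarrow> 'a"
    unfolding image_Un span_Un that ..
  have "dim (vb ` (J \<union> K0)) = card (J \<union> K0)"
    using span_eq_dim[OF span_union[OF spanJ]] span_eq_dim[OF span_union[OF spanJk[of k0]]]
      N(2)[of k0 K0] k0 K0 dimK0 by auto
  then have pos: "\<forall>i\<in>J \<union> K0. a i = 0" if "(\<Sum>i\<in>J \<union> K0. a i *\<^sub>R vb i) = 0" for a
    using that unfolding dim_image_eq_card_iff[OF finJK] by blast
  have "(\<lambda>k. \<Sum>i\<in>A0 \<union> E. b (r k) i *\<^sub>R v (r k) i) \<longlonglongrightarrow> h' yb"
    using LIMSEQ_subseq_LIMSEQ[OF lim r(1)] by (simp add: o_def v_def)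
  moreover have "(\<Sum>i\<in>A0 \<union> E. b (r k) i *\<^sub>R v (r k) i) = (\<Sum>i\<in>J \<union> K0. b' (r k) i *\<^sub>R v (r k) i)" for k
    using K(4)[of "r k"] r(2)[of k] by auto
  ultimately have lim1: "(\<lambda>k. \<Sum>i\<in>J \<union> K0. b' (r k) i *\<^sub>R v (r k) i) \<longlonglongrightarrow> h' yb" by simp
  have "\<exists>b. (\<forall>i\<in>K0. 0 \<le> b i) \<and> h' yb = (\<Sum>i\<in>J \<union> K0. b i *\<^sub>R vb i)"
  proof (rule multiplier_limit[OF finJK _ pos _ _ lim1])
    show "(\<lambda>k. v (r k) i) \<longlonglongrightarrow> vb i" if "i \<in> J \<union> K0" for i
      unfolding v_def vb_def using LIMSEQ_subseq_LIMSEQ[OF c'_lim r(1), of i] that J K0 by (auto simp: o_def)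
    show "0 \<le> b' (r k) i" if "i \<in> K0" for k i
      using K(2)[of "r k"] r(2)[of k] that by auto
  qed auto
  then obtain a where a: "\<forall>i\<in>K0. 0 \<le> a i" "h' yb = (\<Sum>i\<in>J \<union> K0. a i *\<^sub>R vb i)" by blast
  define a' where "a' = (\<lambda>i. if i \<in> J \<union> K0 then a i else 0)"
  have "h' yb = (\<Sum>i\<in>J \<union> K0. a' i *\<^sub>R vb i)" unfolding a(2) by (intro sum.cong) (auto simp: a'_def)
  also have "\<dots> = (\<Sum>i\<in>A0 \<union> E. a' i *\<^sub>R vb i)"
    using finA0 fin J K0 by (intro sum.mono_neutral_left) (auto simp: a'_def)
  finally have "h' yb = (\<Sum>i\<in>A0 \<union> E. a' i *\<^sub>R c' i yb)" by (simp add: vb_def)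
  moreover have "\<forall>i\<in>A0. 0 \<le> a' i" using a(1) J A0A disj by (auto simp: a'_def)
  ultimately show ?thesis by blast
qed

text \<open>
  The hypothesis says that \<open>0\<close> maximizes \<open>u \<bullet> g\<close> under linear constraints, all active at \<open>0\<close>. Their
  gradients are constant, so the constant rank condition is trivial and the multipliers are
  the coefficients sought.
\<close>
corollary Farkas:
  fixes v :: "'i \<Rightarrow> 'a::euclidean_space"
  assumes fin: "finite A" "finite E" and disj: "A \<inter> E = {}"
    and le: "\<And>u. \<forall>i\<in>A. u \<bullet> v i \<le> 0 \<Longrightarrow> \<forall>i\<in>E. u \<bullet> v i = 0 \<Longrightarrow> u \<bullet> g \<le> 0"
  shows "\<exists>b. (\<forall>i\<in>A. 0 \<le> b i) \<and> g = (\<Sum>i\<in>A \<union> E. b i *\<^sub>R v i)"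
proof -
  have lin: "GDERIV (\<lambda>u. u \<bullet> w) y :> w" for w y :: 'a
    unfolding gderiv_def by (auto intro!: derivative_eq_intros)
  show ?thesis
    by (rule KKT_constant_rank[where h="\<lambda>u. u \<bullet> g" and h'="\<lambda>_. g" and c="\<lambda>i u. u \<bullet> v i"
          and c'="\<lambda>i _. v i" and yb=0 and d=1 and A=A])
      (use le fin disj lin in auto)
qed

section \<open>Tangent directions of feasible sets and of inner responses\<close>

text \<open>
  Frechet differentiability gives difference quotients along convergent directions, not only along
  a fixed one; tangent sequences of feasible points need this form.
\<close>
lemma GDERIV_along_sequence:
  fixes h :: "'a::real_inner \<Rightarrow> real"
  assumes h: "GDERIV h z :> g" and w: "w \<longlonglongrightarrow> w0"
    and t: "t \<longlonglongrightarrow> 0" and t_pos: "\<And>k. 0 < t k"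
  shows "(\<lambda>k. (h (z + t k *\<^sub>R w k) - h z) / t k) \<longlonglongrightarrow> w0 \<bullet> g"
proof -
  obtain W where W: "0 < W" "\<And>k. norm (w k) \<le> W"
    using convergent_imp_Bseq[of w] w unfolding convergent_def Bseq_def by blast
  have "(\<lambda>k. (h (z + t k *\<^sub>R w k) - h z) / t k - w k \<bullet> g) \<longlonglongrightarrow> 0"
  proof (rule tendstoI)
    fix e :: real assume e: "0 < e"
    define e' where "e' = e / (2 * W)"
    have e': "0 < e'" using e W by (simp add: e'_def)
    obtain d where d: "0 < d" and D: "\<And>y. norm (y - z) < d \<Longrightarrow>
        norm (h y - h z - (y - z) \<bullet> g) \<le> e' * norm (y - z)"
      using h e' unfolding gderiv_def has_derivative_at_alt by blast
    have "\<forall>\<^sub>F k in sequentially. t k < d / W"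
      using t by (rule order_tendstoD) (use d W in simp)
    then show "\<forall>\<^sub>F k in sequentially. dist ((h (z + t k *\<^sub>R w k) - h z) / t k - w k \<bullet> g) 0 < e"
    proof eventually_elim
      case (elim k)
      have tk: "0 < t k" by (rule t_pos)
      have "norm (t k *\<^sub>R w k) \<le> t k * W" using W(2)[of k] tk by (simp add: mult_left_mono)
      also have "\<dots> < d" using elim W by (simp add: pos_less_divide_eq)
      finally have "norm (h (z + t k *\<^sub>R w k) - h z - (t k *\<^sub>R w k) \<bullet> g) \<le> e' * norm (t k *\<^sub>R w k)"
        using D[of "z + t k *\<^sub>R w k"] by simp
      also have "\<dots> \<le> e' * (t k * W)"
        using W(2)[of k] tk e' by (simp add: mult_left_mono)
      also have "\<dots> = t k * (e / 2)" using W by (simp add: e'_def)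
      finally have "\<bar>(h (z + t k *\<^sub>R w k) - h z - t k * (w k \<bullet> g)) / t k\<bar> \<le> e / 2"
        using tk by (simp add: abs_divide pos_divide_le_eq mult.commute)
      moreover have "(h (z + t k *\<^sub>R w k) - h z) / t k - w k \<bullet> g
          = (h (z + t k *\<^sub>R w k) - h z - t k * (w k \<bullet> g)) / t k"
        using tk by (simp add: diff_divide_distrib)
      ultimately show ?case using e by (simp only: dist_real_def diff_zero)
    qed
  qed
  moreover have "(\<lambda>k. w k \<bullet> g) \<longlonglongrightarrow> w0 \<bullet> g" by (intro tendsto_intros w)
  ultimately have "(\<lambda>k. ((h (z + t k *\<^sub>R w k) - h z) / t k - w k \<bullet> g) + w k \<bullet> g) \<longlonglongrightarrow> 0 + w0 \<bullet> g"
    by (rule tendsto_add)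
  then show ?thesis by simp
qed

text \<open>
  The bound comes from clipping \<open>z\<close> into the cone coordinatewise and replacing the Euclidean norm of
  the error by its absolute sum.
\<close>
lemma coord_dist_constraint_cone_le:
  "coord_dist (k + l) z (constraint_cone k l) \<le> (\<Sum>i<k + l. if i < k then max 0 (z i) else \<bar>z i\<bar>)"
proof -
  define c where "c = (\<lambda>i. if i < k then min (z i) 0 else 0)"
  have "c \<in> constraint_cone k l" by (auto simp: c_def constraint_cone_def)
  moreover have "bdd_below ((\<lambda>c. L2_set (\<lambda>i. z i - c i) {..<k + l}) ` constraint_cone k l)"
    by (rule bdd_belowI2[of _ 0]) simp
  ultimately have "coord_dist (k + l) z (constraint_cone k l) \<le> L2_set (\<lambda>i. z i - c i) {..<k + l}"
    unfolding coord_dist_def by (intro cINF_lower)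
  also have "\<dots> \<le> (\<Sum>i<k + l. \<bar>z i - c i\<bar>)" by (rule L2_set_le_sum_abs)
  also have "\<dots> = (\<Sum>i<k + l. if i < k then max 0 (z i) else \<bar>z i\<bar>)"
    by (intro sum.cong) (auto simp: c_def)
  finally show ?thesis .
qed

text \<open>
  Along \<open>xb + t u\<close> the constraints are violated by \<open>o(t)\<close> only, so metric subregularity provides a
  feasible point at distance \<open>o(t)\<close>. Thus the linearized cone consists of tangent directions.
\<close>
lemma MSCQ_tangent_sequence:
  fixes \<phi> :: "'a::euclidean_space \<Rightarrow> nat \<Rightarrow> real"
  assumes mscq: "MSCQ \<phi> p1 p2 xb"
    and cont: "\<And>i. i < p1 + p2 \<Longrightarrow> continuous_on UNIV (\<lambda>x. \<phi> x i)"
    and \<phi>': "\<And>i. i < p1 + p2 \<Longrightarrow> GDERIV (\<lambda>x. \<phi> x i) xb :> \<phi>' i"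
    and xb: "xb \<in> feasible_x \<phi> p1 p2"
    and u: "\<And>i. i < p1 \<Longrightarrow> \<phi> xb i = 0 \<Longrightarrow> u \<bullet> \<phi>' i \<le> 0"
      "\<And>i. i \<in> {p1..<p1 + p2} \<Longrightarrow> u \<bullet> \<phi>' i = 0"
    and t: "t \<longlonglongrightarrow> 0" and t_pos: "\<And>k. 0 < t k"
  shows "\<exists>x. (\<forall>k. x k \<in> feasible_x \<phi> p1 p2) \<and> (\<lambda>k. (x k - xb) /\<^sub>R t k) \<longlonglongrightarrow> u"
proof -
  define X where "X = feasible_x \<phi> p1 p2"
  have "X = (\<Inter>i\<in>{..<p1}. {x. \<phi> x i \<le> 0}) \<inter> (\<Inter>i\<in>{p1..<p1+p2}. {x. \<phi> x i = 0})"
    by (auto simp: X_def feasible_x_def constraint_cone_def)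
  also have "closed \<dots>"
    using cont by (intro closed_Int closed_INT ballI closed_Collect_le closed_Collect_eq continuous_intros) auto
  finally have closed: "closed X" .
  have ne: "X \<noteq> {}" using xb by (auto simp: X_def)
  define z where "z = (\<lambda>k. xb + t k *\<^sub>R u)"
  have "\<exists>x\<in>X. infdist (z k) X = dist (z k) x" for k
    using infdist_attains_inf[OF closed ne, of "z k"] by metis
  then obtain x where x: "\<And>k. x k \<in> X" "\<And>k. infdist (z k) X = dist (z k) (x k)" by metis
  have z: "z \<longlonglongrightarrow> xb"
    unfolding z_def by (rule tendsto_eq_intros t refl | simp)+
  obtain U \<rho> where U: "open U" "xb \<in> U" "0 < \<rho>"
    and est: "\<And>x. x \<in> U \<Longrightarrow> infdist x X \<le> \<rho> * coord_dist (p1 + p2) (\<phi> x) (constraint_cone p1 p2)"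
    using mscq unfolding MSCQ_def X_def by blast
  define viol where "viol = (\<lambda>i (s::real). if i < p1 then max 0 s else \<bar>s\<bar>)"
  have viol_lim: "(\<lambda>k. viol i (\<phi> (z k) i) / t k) \<longlonglongrightarrow> 0" if i: "i < p1 + p2" for i
  proof -
    have quot: "(\<lambda>k. (\<phi> (z k) i - \<phi> xb i) / t k) \<longlonglongrightarrow> u \<bullet> \<phi>' i"
      unfolding z_def by (rule GDERIV_along_sequence[OF \<phi>'[OF i] tendsto_const t t_pos])
    have "i < p1 \<Longrightarrow> \<phi> xb i \<le> 0" "p1 \<le> i \<Longrightarrow> \<phi> xb i = 0"
      using xb i by (auto simp: feasible_x_def constraint_cone_def)
    then consider "i < p1" "\<phi> xb i = 0" | "i < p1" "\<phi> xb i < 0" | "p1 \<le> i" "\<phi> xb i = 0"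
      by (meson not_le order_le_less)
    then show ?thesis
    proof cases
      case 1
      have "(\<lambda>k. max 0 ((\<phi> (z k) i - \<phi> xb i) / t k)) \<longlonglongrightarrow> max 0 (u \<bullet> \<phi>' i)"
        by (intro tendsto_intros quot)
      moreover have "max 0 ((\<phi> (z k) i - \<phi> xb i) / t k) = viol i (\<phi> (z k) i) / t k" for k
        using 1 t_pos[of k] by (auto simp: viol_def max_def zero_le_divide_iff)
      ultimately show ?thesis using u(1)[OF 1] by (simp add: max_absorb1)
    next
      case 2
      have "(\<lambda>k. \<phi> (z k) i) \<longlonglongrightarrow> \<phi> xb i"
        using cont[OF i] z by (rule continuous_on_tendsto_compose) auto
      then have "\<forall>\<^sub>F k in sequentially. \<phi> (z k) i < 0" by (rule order_tendstoD) (rule 2)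
      then have "\<forall>\<^sub>F k in sequentially. viol i (\<phi> (z k) i) / t k = 0"
        by eventually_elim (use 2 in \<open>simp add: viol_def\<close>)
      then show ?thesis by (rule tendsto_eventually)
    next
      case 3
      have "(\<lambda>k. \<bar>(\<phi> (z k) i - \<phi> xb i) / t k\<bar>) \<longlonglongrightarrow> \<bar>u \<bullet> \<phi>' i\<bar>"
        by (intro tendsto_intros quot)
      moreover have "\<bar>(\<phi> (z k) i - \<phi> xb i) / t k\<bar> = viol i (\<phi> (z k) i) / t k" for k
        using 3 t_pos[of k] by (simp add: viol_def abs_divide)
      ultimately show ?thesis using u(2)[of i] 3 i by simp
    qed
  qed
  have "(\<lambda>k. (x k - z k) /\<^sub>R t k) \<longlonglongrightarrow> 0"
  proof (rule Lim_null_comparison)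
    have "\<forall>\<^sub>F k in sequentially. z k \<in> U"
      by (rule topological_tendstoD[OF z U(1,2)])
    then show "\<forall>\<^sub>F k in sequentially. norm ((x k - z k) /\<^sub>R t k)
        \<le> \<rho> * (\<Sum>i<p1 + p2. viol i (\<phi> (z k) i) / t k)"
    proof eventually_elim
      case (elim k)
      have "norm (x k - z k) = infdist (z k) X" by (simp add: x(2) dist_norm norm_minus_commute)
      also have "\<dots> \<le> \<rho> * coord_dist (p1 + p2) (\<phi> (z k)) (constraint_cone p1 p2)"
        by (rule est[OF elim])
      also have "\<dots> \<le> \<rho> * (\<Sum>i<p1 + p2. viol i (\<phi> (z k) i))"
        unfolding viol_def using U(3) coord_dist_constraint_cone_le by (intro mult_left_mono) auto
      finally have "norm (x k - z k) / t k \<le> \<rho> * (\<Sum>i<p1 + p2. viol i (\<phi> (z k) i)) / t k"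
        using t_pos[of k] by (intro divide_right_mono) auto
      also have "\<dots> = \<rho> * (\<Sum>i<p1 + p2. viol i (\<phi> (z k) i) / t k)"
        by (simp only: times_divide_eq_right[symmetric] sum_divide_distrib)
      also have "norm (x k - z k) / t k = norm ((x k - z k) /\<^sub>R t k)"
        using t_pos[of k] by (simp add: divide_inverse mult.commute)
      finally show ?case .
    qed
    have "(\<lambda>k. \<rho> * (\<Sum>i<p1 + p2. viol i (\<phi> (z k) i) / t k)) \<longlonglongrightarrow> \<rho> * (\<Sum>i<p1 + p2. 0)"
      by (intro tendsto_intros viol_lim) auto
    then show "(\<lambda>k. \<rho> * (\<Sum>i<p1 + p2. viol i (\<phi> (z k) i) / t k)) \<longlonglongrightarrow> 0" by simp
  qed
  from tendsto_add[OF this tendsto_const[of u]]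
  have "(\<lambda>k. (x k - z k) /\<^sub>R t k + u) \<longlonglongrightarrow> u" by simp
  moreover have "(x k - z k) /\<^sub>R t k + u = (x k - xb) /\<^sub>R t k" for k
    using t_pos[of k] by (simp add: z_def algebra_simps)
  ultimately show ?thesis using x(1) unfolding X_def by (intro exI[of _ x]) simp
qed

text \<open>
  Calmness is what makes the inner responses comparable with the outer perturbation: for
  \<open>x\<^sub>k = xb + t\<^sub>k u + o(t\<^sub>k)\<close> there is eventually a response \<open>y\<^sub>k \<in> Y x\<^sub>k\<close> with \<open>norm (y\<^sub>k - yb) \<le> \<kappa> (norm u + 1) t\<^sub>k\<close> and
  \<open>f (xb, yb) \<le> f (x\<^sub>k, y\<^sub>k)\<close>. A limit point \<open>v\<close> of the quotients \<open>(y\<^sub>k - yb) / t\<^sub>k\<close> then satisfies the linearized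
  constraints and does not decrease \<open>f\<close> to first order.
\<close>
lemma calm_minimax_ascent_direction:
  fixes f :: "'x::euclidean_space \<times> 'y::euclidean_space \<Rightarrow> real"
  assumes minimax: "calm_local_minimax f X (feasible_y \<psi> q1 q2) xb yb"
    and f': "GDERIV f (xb, yb) :> (gx, gy)"
    and \<psi>': "\<And>i. i < q1 + q2 \<Longrightarrow> GDERIV (\<lambda>z. \<psi> z i) (xb, yb) :> (ax i, ay i)"
    and x: "\<And>k. x k \<in> X" and u: "(\<lambda>k. (x k - xb) /\<^sub>R t k) \<longlonglongrightarrow> u"
    and t: "t \<longlonglongrightarrow> 0" and t_pos: "\<And>k. 0 < t k"
  shows "\<exists>v. 0 \<le> u \<bullet> gx + v \<bullet> gy \<and>
           (\<forall>i<q1. \<psi> (xb, yb) i = 0 \<longrightarrow> u \<bullet> ax i + v \<bullet> ay i \<le> 0) \<and>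
           (\<forall>i\<in>{q1..<q1 + q2}. u \<bullet> ax i + v \<bullet> ay i = 0)"
proof -
  define Y where "Y = feasible_y \<psi> q1 q2"
  obtain \<delta>0 \<tau> \<kappa> where \<delta>0: "0 < \<delta>0" and \<kappa>: "0 < \<kappa>"
    and yb: "yb \<in> Y xb" and \<tau>: "\<And>\<delta>. \<delta> \<in> {0<..\<delta>0} \<Longrightarrow> \<tau> \<delta> \<le> \<kappa> * \<delta>"
    and mm: "\<And>\<delta> x y. \<delta> \<in> {0<..\<delta>0} \<Longrightarrow> x \<in> X \<inter> cball xb \<delta> \<Longrightarrow> y \<in> Y xb \<inter> cball yb \<delta> \<Longrightarrow>
        \<exists>ym. is_arg_max (\<lambda>y'. f (x, y')) (\<lambda>y'. y' \<in> Y x \<inter> cball yb (\<tau> \<delta>)) ym \<and> f (xb, yb) \<le> f (x, ym)"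
    using minimax unfolding calm_local_minimax_def Y_def by blast
  \<comment> \<open>The ball of radius \<open>\<delta> = t k * c\<close> contains \<open>x k\<close> as soon as the quotient has norm less than \<open>c\<close>.\<close>
  define c where "c = norm u + 1"
  have c: "0 < c" unfolding c_def by (simp add: add_nonneg_pos)
  have "\<forall>\<^sub>F k in sequentially. norm ((x k - xb) /\<^sub>R t k) < c"
    using tendsto_norm[OF u] by (rule order_tendstoD) (simp add: c_def)
  moreover have "\<forall>\<^sub>F k in sequentially. t k < \<delta>0 / c"
    using t by (rule order_tendstoD) (use \<delta>0 c in simp)
  ultimately have "\<forall>\<^sub>F k in sequentially.
      \<exists>ym. ym \<in> Y (x k) \<and> norm ((ym - yb) /\<^sub>R t k) \<le> \<kappa> * c \<and> f (xb, yb) \<le> f (x k, ym)"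
  proof eventually_elim
    case (elim k)
    have tk: "0 < t k" by (rule t_pos)
    define \<delta> where "\<delta> = t k * c"
    have \<delta>: "\<delta> \<in> {0<..\<delta>0}" using elim(2) c tk by (simp add: \<delta>_def pos_less_divide_eq)
    have norm_x: "norm (a /\<^sub>R t k) = norm a / t k" for a :: 'x
      using tk by (simp add: divide_inverse mult.commute)
    have norm_y: "norm (a /\<^sub>R t k) = norm a / t k" for a :: 'y
      using tk by (simp add: divide_inverse mult.commute)
    have "norm (x k - xb) \<le> \<delta>"
      using elim(1) tk by (simp add: norm_x \<delta>_def pos_divide_less_eq mult.commute less_imp_le del: norm_scaleR)
    then have xk: "x k \<in> X \<inter> cball xb \<delta>" using x by (simp add: dist_norm norm_minus_commute)
    have "yb \<in> Y xb \<inter> cball yb \<delta>" using yb \<delta> by simp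
    from mm[OF \<delta> xk this] obtain ym where ym: "ym \<in> Y (x k)" "dist yb ym \<le> \<tau> \<delta>" "f (xb, yb) \<le> f (x k, ym)"
      by (auto simp: is_arg_max_def)
    have "norm (ym - yb) \<le> \<kappa> * (t k * c)"
      using ym(2) \<tau>[OF \<delta>] by (simp add: \<delta>_def dist_norm norm_minus_commute)
    then have "norm ((ym - yb) /\<^sub>R t k) \<le> \<kappa> * c"
      using tk c \<kappa> by (simp add: norm_y pos_divide_le_eq mult_ac del: norm_scaleR)
    then show ?case using ym by blast
  qed
  then obtain N where N: "\<And>k. k \<ge> N \<Longrightarrow>
      \<exists>ym. ym \<in> Y (x k) \<and> norm ((ym - yb) /\<^sub>R t k) \<le> \<kappa> * c \<and> f (xb, yb) \<le> f (x k, ym)"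
    unfolding eventually_sequentially by blast
  then have "\<exists>ym. ym \<in> Y (x (k + N)) \<and> norm ((ym - yb) /\<^sub>R t (k + N)) \<le> \<kappa> * c \<and> f (xb, yb) \<le> f (x (k + N), ym)" for k
    by simp
  then obtain y where y: "\<And>k. y k \<in> Y (x (k + N))" "\<And>k. norm ((y k - yb) /\<^sub>R t (k + N)) \<le> \<kappa> * c"
    "\<And>k. f (xb, yb) \<le> f (x (k + N), y k)" by metis
  have "\<forall>k. (y k - yb) /\<^sub>R t (k + N) \<in> cball 0 (\<kappa> * c)" using y(2) by simp
  then obtain v r where r: "strict_mono r" and v: "((\<lambda>k. (y k - yb) /\<^sub>R t (k + N)) \<circ> r) \<longlonglongrightarrow> v"
    by (rule seq_compactE[OF compact_imp_seq_compact[OF compact_cball]])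
  define T where "T = (\<lambda>k. t (r k + N))"
  define z where "z = (\<lambda>k. (x (r k + N), y (r k)))"
  define w where "w = (\<lambda>k. ((x (r k + N) - xb) /\<^sub>R T k, (y (r k) - yb) /\<^sub>R T k))"
  have rN: "strict_mono (\<lambda>k. r k + N)" using r by (simp add: strict_mono_def)
  have T: "T \<longlonglongrightarrow> 0" using LIMSEQ_subseq_LIMSEQ[OF t rN] by (simp add: T_def o_def)
  have T_pos: "0 < T k" for k by (simp add: T_def t_pos)
  have w: "w \<longlonglongrightarrow> (u, v)"
    unfolding w_def T_def using LIMSEQ_subseq_LIMSEQ[OF u rN] v by (intro tendsto_Pair) (simp_all add: o_def)
  have zw: "(xb, yb) + T k *\<^sub>R w k = z k" for k
    using T_pos[of k] by (simp add: z_def w_def)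
  have quot: "(\<lambda>k. (h (z k) - h (xb, yb)) / T k) \<longlonglongrightarrow> u \<bullet> a + v \<bullet> b"
    if "GDERIV h (xb, yb) :> (a, b)" for h a b
    using GDERIV_along_sequence[OF that w T T_pos] by (simp add: zw)
  have feas: "\<psi> (z k) \<in> constraint_cone q1 q2" for k
    using y(1)[of "r k"] by (simp add: z_def Y_def feasible_y_def)
  have feasb: "\<psi> (xb, yb) \<in> constraint_cone q1 q2"
    using yb by (simp add: Y_def feasible_y_def)
  have "0 \<le> u \<bullet> gx + v \<bullet> gy"
    by (rule LIMSEQ_le_const[OF quot[OF f']]) (use y(3) T_pos in \<open>auto simp: z_def less_imp_le\<close>)
  moreover have "u \<bullet> ax i + v \<bullet> ay i \<le> 0" if "i < q1" "\<psi> (xb, yb) i = 0" for i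
    by (rule LIMSEQ_le_const2[OF quot[OF \<psi>']])
       (use that feas T_pos in \<open>auto simp: constraint_cone_def divide_nonpos_pos\<close>)
  moreover have "u \<bullet> ax i + v \<bullet> ay i = 0" if "i \<in> {q1..<q1 + q2}" for i
    by (rule LIMSEQ_unique[OF quot[OF \<psi>'] tendsto_eventually])
       (use that feas feasb in \<open>auto simp: constraint_cone_def\<close>)
  ultimately show ?thesis by blast
qed

section \<open>Stationarity of calm local minimax points\<close>

lemma GDERIV_section:
  fixes h :: "'x::real_inner \<times> 'y::real_inner \<Rightarrow> real"
  assumes "GDERIV h (x, y) :> g"
  shows "GDERIV (\<lambda>y. h (x, y)) y :> snd g"
proof -
  have "((\<lambda>y. (x, y)) has_derivative (\<lambda>v. (0, v))) (at y)"
    by (auto intro!: derivative_eq_intros)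
  from has_derivative_compose[OF this, of h "\<lambda>v. v \<bullet> g"] assms show ?thesis
    unfolding gderiv_def by (simp add: inner_prod_def)
qed

text \<open>
  The partial gradients in \<open>y\<close> are the constant vectors \<open>B i\<close>, so all the ranks are constant.
\<close>
lemma RCRCQ_if_affine:
  fixes \<psi> :: "'x::euclidean_space \<times> 'y::euclidean_space \<Rightarrow> nat \<Rightarrow> real"
  assumes \<psi>: "\<And>x y i. i < q1 + q2 \<Longrightarrow> \<psi> (x, y) i = a x i + inner (B i) y + c i"
  shows "RCRCQ \<psi> q1 q2 xb yb"
proof -
  have grad: "grad_y \<psi> i z = B i" if "i < q1 + q2" for i z
    unfolding grad_y_def
  proof (rule gradient_eqI)
    have "(\<lambda>y. \<psi> (fst z, y) i) = (\<lambda>y. a (fst z) i + inner (B i) y + c i)" using \<psi>[OF that] by simp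
    then show "GDERIV (\<lambda>y. \<psi> (fst z, y) i) (snd z) :> B i"
      unfolding gderiv_def by (auto intro!: derivative_eq_intros simp: inner_commute)
  qed
  have "(\<lambda>i. grad_y \<psi> i z) ` ({q1..<q1+q2} \<union> K) = B ` ({q1..<q1+q2} \<union> K)"
    if "K \<subseteq> active_ineq \<psi> q1 (xb, yb)" for K z
    using that by (intro image_cong refl grad) (auto simp: active_ineq_def)
  then show ?thesis unfolding RCRCQ_def by simp
qed

text \<open>
  For fixed \<open>xb\<close> the point \<open>yb\<close> is a local maximizer of the inner problem, so both constraint
  qualifications lead to the multiplier rule for \<open>f (xb, \<cdot>)\<close>. A neighbourhood of \<open>(xb, yb)\<close> meets the
  slice through \<open>xb\<close> in a neighbourhood of \<open>yb\<close>, so constant rank passes to the inner problem.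
\<close>
lemma lower_level_KKT:
  fixes f :: "'x::euclidean_space \<times> 'y::euclidean_space \<Rightarrow> real"
  assumes f': "\<And>z. GDERIV f z :> f' z" "continuous_on UNIV f'"
    and \<psi>': "\<And>i z. i < q1 + q2 \<Longrightarrow> GDERIV (\<lambda>z. \<psi> z i) z :> \<psi>' i z"
      "\<And>i. i < q1 + q2 \<Longrightarrow> continuous_on UNIV (\<psi>' i)"
    and yb: "yb \<in> feasible_y \<psi> q1 q2 xb"
    and d: "0 < d"
    and max: "\<And>y. y \<in> feasible_y \<psi> q1 q2 xb \<Longrightarrow> y \<in> cball yb d \<Longrightarrow> f (xb, y) \<le> f (xb, yb)"
    and cq: "MFCQ \<psi> q1 q2 xb yb \<or> RCRCQ \<psi> q1 q2 xb yb"
  shows "\<exists>\<beta>. (\<forall>i\<in>active_ineq \<psi> q1 (xb, yb). 0 \<le> \<beta> i) \<and>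
    snd (f' (xb, yb)) = (\<Sum>i\<in>active_ineq \<psi> q1 (xb, yb) \<union> {q1..<q1 + q2}. \<beta> i *\<^sub>R snd (\<psi>' i (xb, yb)))"
proof -
  define A0 where "A0 = active_ineq \<psi> q1 (xb, yb)"
  define E where "E = {q1..<q1 + q2}"
  define A where "A = {..<q1}"
  define h where "h = (\<lambda>y. f (xb, y))"
  define h' where "h' = (\<lambda>y. snd (f' (xb, y)))"
  define c where "c = (\<lambda>i y. \<psi> (xb, y) i)"
  define c' where "c' = (\<lambda>i y. snd (\<psi>' i (xb, y)))"
  have fin: "finite A" "finite E" and disj: "A \<inter> E = {}" by (auto simp: A_def E_def)
  have slice_cont: "isCont (\<lambda>y. snd (g (xb, y))) yb" if "continuous_on UNIV g" for g :: "'x \<times> 'y \<Rightarrow> 'x \<times> 'y"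
    using that by (intro continuous_intros isCont_o2[where f="\<lambda>y. (xb, y)" and g=g])
      (auto simp: continuous_on_eq_continuous_at)
  have h'1: "GDERIV h y :> h' y" for y
    unfolding h_def h'_def by (intro GDERIV_section f')
  have h'2: "isCont h' yb" unfolding h'_def by (intro slice_cont f')
  have c'1: "GDERIV (c i) y :> c' i y" if "i \<in> A \<union> E" for i y
    unfolding c_def c'_def using that by (intro GDERIV_section \<psi>') (auto simp: A_def E_def)
  have c'2: "isCont (c' i) yb" if "i \<in> A \<union> E" for i
    unfolding c'_def using that by (intro slice_cont \<psi>') (auto simp: A_def E_def)
  have feas: "y \<in> feasible_y \<psi> q1 q2 xb \<longleftrightarrow> (\<forall>i\<in>A. c i y \<le> 0) \<and> (\<forall>i\<in>E. c i y = 0)" for y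
    by (auto simp: feasible_y_def constraint_cone_def c_def A_def E_def)
  have feas1: "c i yb \<le> 0" if "i \<in> A" for i using yb that unfolding feas by blast
  have feas2: "c i yb = 0" if "i \<in> E" for i using yb that unfolding feas by blast
  have max': "h y \<le> h yb" if "y \<in> cball yb d" "\<forall>i\<in>A. c i y \<le> 0" "\<forall>i\<in>E. c i y = 0" for y
    unfolding h_def using that max feas by blast
  have A0: "A0 = {i\<in>A. c i yb = 0}" by (auto simp: A0_def active_ineq_def A_def c_def)
  have grad: "grad_y \<psi> i (xb, y) = c' i y" if "i \<in> A \<union> E" for i y
    unfolding grad_y_def using c'1[OF that] by (intro gradient_eqI) (simp add: c_def)
  have "\<exists>b. (\<forall>i\<in>A0. 0 \<le> b i) \<and> h' yb = (\<Sum>i\<in>A0 \<union> E. b i *\<^sub>R c' i yb)"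
    using cq
  proof
    assume mf: "MFCQ \<psi> q1 q2 xb yb"
    have gE: "(\<lambda>j. grad_y \<psi> j (xb, yb)) ` E = (\<lambda>j. c' j yb) ` E"
      by (intro image_cong refl grad) auto
    have "inj_on (\<lambda>j. grad_y \<psi> j (xb, yb)) E = inj_on (\<lambda>j. c' j yb) E"
      by (intro inj_on_cong grad) auto
    with mf gE have ind: "inj_on (\<lambda>j. c' j yb) E" "independent ((\<lambda>j. c' j yb) ` E)"
      unfolding MFCQ_def E_def by auto
    obtain w where w: "\<And>j. j \<in> E \<Longrightarrow> inner (grad_y \<psi> j (xb, yb)) w = 0"
      "\<And>i. i \<in> A0 \<Longrightarrow> inner (grad_y \<psi> i (xb, yb)) w < 0"
      using mf unfolding MFCQ_def E_def A0_def by blast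
    have pos: "\<forall>i\<in>A0 \<union> E. b i = 0"
      if "\<forall>i\<in>A0. 0 \<le> b i" "(\<Sum>i\<in>A0 \<union> E. b i *\<^sub>R c' i yb) = 0" for b
    proof (rule positively_independent_of_MFCQ[where v="\<lambda>i. c' i yb" and w=w])
      show "dim ((\<lambda>j. c' j yb) ` E) = card E"
        using ind by (simp add: dim_eq_card_independent card_image)
      show "c' i yb \<bullet> w = 0" if "i \<in> E" for i using w(1)[OF that] grad[of i yb] that by simp
      show "c' i yb \<bullet> w < 0" if "i \<in> A0" for i using w(2)[OF that] grad[of i yb] that A0 by simp
    qed (use that fin disj A0 in auto)
    show ?thesis
      by (rule KKT_positively_independent[where h=h and h'=h' and c=c and c'=c' and yb=yb and A=A and d=d]) fact+
  next
    assume rc: "RCRCQ \<psi> q1 q2 xb yb"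
    have rank: "\<forall>\<^sub>F y in nhds yb. dim ((\<lambda>i. c' i y) ` (E \<union> K)) = dim ((\<lambda>i. c' i yb) ` (E \<union> K))"
      if K: "K \<subseteq> A0" for K
    proof -
      have "\<forall>\<^sub>F z in nhds (xb, yb). dim ((\<lambda>i. grad_y \<psi> i z) ` (E \<union> K)) =
        dim ((\<lambda>i. grad_y \<psi> i (xb, yb)) ` (E \<union> K))"
        using rc K unfolding RCRCQ_def E_def A0_def by blast
      moreover have "filterlim (\<lambda>y. (xb, y)) (nhds (xb, yb)) (nhds yb)"
        by (intro tendsto_Pair tendsto_const filterlim_ident)
      ultimately have "\<forall>\<^sub>F y in nhds yb. dim ((\<lambda>i. grad_y \<psi> i (xb, y)) ` (E \<union> K)) =
        dim ((\<lambda>i. grad_y \<psi> i (xb, yb)) ` (E \<union> K))"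
        by (rule eventually_compose_filterlim)
      moreover have "(\<lambda>i. grad_y \<psi> i (xb, y)) ` (E \<union> K) = (\<lambda>i. c' i y) ` (E \<union> K)" for y
        using K A0 by (intro image_cong refl grad) auto
      ultimately show ?thesis by simp
    qed
    show ?thesis
      by (rule KKT_constant_rank[where h=h and h'=h' and c=c and c'=c' and yb=yb and A=A and d=d]) fact+
  qed
  then show ?thesis by (simp add: A0_def E_def h'_def c'_def)
qed

lemma GDERIV_lagrangian:
  fixes f :: "'x::euclidean_space \<times> 'y::euclidean_space \<Rightarrow> real"
  assumes f': "GDERIV f (xb, yb) :> (gx, gy)"
    and \<phi>': "\<And>i. i < p \<Longrightarrow> GDERIV (\<lambda>x. \<phi> x i) xb :> \<phi>' i"
    and \<psi>': "\<And>i. i < q \<Longrightarrow> GDERIV (\<lambda>z. \<psi> z i) (xb, yb) :> (ax i, ay i)"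
  shows "GDERIV (\<lambda>(x, y). lagrangian f \<phi> p \<psi> q x y \<alpha> \<beta>) (xb, yb) :>
    (gx + (\<Sum>i<p. \<alpha> i *\<^sub>R \<phi>' i) - (\<Sum>i<q. \<beta> i *\<^sub>R ax i), gy - (\<Sum>i<q. \<beta> i *\<^sub>R ay i))"
proof -
  have "((\<lambda>z. \<phi> (fst z) i) has_derivative (\<lambda>h. fst h \<bullet> \<phi>' i)) (at (xb, yb))" if "i < p" for i
    using has_derivative_compose[OF has_derivative_fst[OF has_derivative_ident], of "\<lambda>x. \<phi> x i" _ "(xb, yb)" UNIV] \<phi>'[OF that]
    unfolding gderiv_def by simp
  then have "((\<lambda>z. f z + (\<Sum>i<p. \<phi> (fst z) i * \<alpha> i) - (\<Sum>i<q. \<psi> z i * \<beta> i)) has_derivative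
      (\<lambda>h. h \<bullet> (gx, gy) + (\<Sum>i<p. (fst h \<bullet> \<phi>' i) * \<alpha> i) - (\<Sum>i<q. (h \<bullet> (ax i, ay i)) * \<beta> i))) (at (xb, yb))"
    using f' \<psi>' unfolding gderiv_def
    by (intro has_derivative_add has_derivative_diff has_derivative_sum has_derivative_mult_left) auto
  moreover have "(\<lambda>(x, y). lagrangian f \<phi> p \<psi> q x y \<alpha> \<beta>)
      = (\<lambda>z. f z + (\<Sum>i<p. \<phi> (fst z) i * \<alpha> i) - (\<Sum>i<q. \<psi> z i * \<beta> i))"
    by (auto simp: lagrangian_def)
  moreover have "(\<lambda>h. h \<bullet> (gx, gy) + (\<Sum>i<p. (fst h \<bullet> \<phi>' i) * \<alpha> i) - (\<Sum>i<q. (h \<bullet> (ax i, ay i)) * \<beta> i))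
      = (\<lambda>h. h \<bullet> (gx + (\<Sum>i<p. \<alpha> i *\<^sub>R \<phi>' i) - (\<Sum>i<q. \<beta> i *\<^sub>R ax i), gy - (\<Sum>i<q. \<beta> i *\<^sub>R ay i)))"
    by (auto simp: fun_eq_iff inner_add_right inner_diff_right inner_sum_right sum.distrib distrib_left mult.commute)
  ultimately show ?thesis unfolding gderiv_def by simp
qed

theorem corollary5p1:
  fixes f :: "(real ^ 'n) \<times> (real ^ 'm) \<Rightarrow> real"
    and \<phi> :: "real ^ 'n \<Rightarrow> nat \<Rightarrow> real"
    and \<psi> :: "(real ^ 'n) \<times> (real ^ 'm) \<Rightarrow> nat \<Rightarrow> real"
    and p1 p2 q1 q2 :: nat
    and X :: "(real ^ 'n) set"
    and Y :: "real ^ 'n \<Rightarrow> (real ^ 'm) set"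
    and xb :: "real ^ 'n" and yb :: "real ^ 'm"
  assumes f_smooth: "cont_differentiable f"
    and phi_smooth: "\<And>i. i < p1 + p2 \<Longrightarrow> cont_differentiable (\<lambda>x. \<phi> x i)"
    and psi_smooth: "\<And>i. i < q1 + q2 \<Longrightarrow> cont_differentiable (\<lambda>z. \<psi> z i)"
    and X_eq: "X = feasible_x \<phi> p1 p2"
    and Y_eq: "Y = feasible_y \<psi> q1 q2"
    and X_nonempty: "X \<noteq> {}"
    and Y_nonempty: "\<And>x. x \<in> X \<Longrightarrow> Y x \<noteq> {}"
    and inner_max: "\<And>x. x \<in> X \<Longrightarrow> \<exists>y. is_arg_max (\<lambda>y'. f (x, y')) (\<lambda>y'. y' \<in> Y x) y"
    and minimax: "calm_local_minimax f X Y xb yb"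
    and mscq: "MSCQ \<phi> p1 p2 xb"
    and cq: "MFCQ \<psi> q1 q2 xb yb
      \<or> RCRCQ \<psi> q1 q2 xb yb
      \<or> ((\<exists>(a :: real ^ 'n \<Rightarrow> nat \<Rightarrow> real) (B :: nat \<Rightarrow> real ^ 'm) (c :: nat \<Rightarrow> real).
             (\<forall>i<q1+q2. continuous_on UNIV (\<lambda>x. a x i)) \<and>
             (\<forall>x y. \<forall>i<q1+q2. \<psi> (x, y) i = a x i + inner (B i) y + c i))
         \<and> (\<forall>\<^sub>F x in nhds xb. Y x \<noteq> {}))"
  shows "\<exists>\<alpha> \<beta> :: nat \<Rightarrow> real.
      (\<forall>i<p1. \<alpha> i \<ge> 0) \<and> (\<forall>i<q1. \<beta> i \<ge> 0) \<and>
      (\<Sum>i<p1. \<alpha> i * \<phi> xb i) = 0 \<and>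
      (\<Sum>i<q1. \<beta> i * \<psi> (xb, yb) i) = 0 \<and>
      GDERIV (\<lambda>(x, y). lagrangian f \<phi> (p1 + p2) \<psi> (q1 + q2) x y \<alpha> \<beta>) (xb, yb) :> 0"
proof -
  obtain f' where f': "\<And>z. GDERIV f z :> f' z" "continuous_on UNIV f'"
    using f_smooth unfolding cont_differentiable_def by blast
  have "\<exists>g. \<forall>i<p1 + p2. \<forall>x. GDERIV (\<lambda>x. \<phi> x i) x :> g i x"
    using phi_smooth unfolding cont_differentiable_def by metis
  then obtain \<phi>'0 where \<phi>'0: "\<And>i x. i < p1 + p2 \<Longrightarrow> GDERIV (\<lambda>x. \<phi> x i) x :> \<phi>'0 i x" by blast
  have "\<exists>g. \<forall>i<q1 + q2. (\<forall>z. GDERIV (\<lambda>z. \<psi> z i) z :> g i z) \<and> continuous_on UNIV (g i)"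
    using psi_smooth unfolding cont_differentiable_def by metis
  then obtain \<psi>' where \<psi>': "\<And>i z. i < q1 + q2 \<Longrightarrow> GDERIV (\<lambda>z. \<psi> z i) z :> \<psi>' i z"
    "\<And>i. i < q1 + q2 \<Longrightarrow> continuous_on UNIV (\<psi>' i)" by blast
  define \<phi>' where "\<phi>' = (\<lambda>i. \<phi>'0 i xb)"
  define gx where "gx = fst (f' (xb, yb))"
  define gy where "gy = snd (f' (xb, yb))"
  define ax where "ax = (\<lambda>i. fst (\<psi>' i (xb, yb)))"
  define ay where "ay = (\<lambda>i. snd (\<psi>' i (xb, yb)))"
  define A0 where "A0 = active_ineq \<psi> q1 (xb, yb)"
  define E where "E = {q1..<q1 + q2}"
  define P0 where "P0 = {i. i < p1 \<and> \<phi> xb i = 0}"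
  define F where "F = {p1..<p1 + p2}"
  have A0_iff: "i \<in> A0 \<longleftrightarrow> i < q1 \<and> \<psi> (xb, yb) i = 0" for i by (simp add: A0_def active_ineq_def)
  have fin: "finite A0" "finite E" "finite P0" "finite F"
    and sub: "A0 \<union> E \<subseteq> {..<q1 + q2}" "P0 \<union> F \<subseteq> {..<p1 + p2}"
    and disj: "P0 \<inter> F = {}"
    by (auto simp: A0_def active_ineq_def E_def P0_def F_def)
  have fg: "GDERIV f (xb, yb) :> (gx, gy)" using f'(1) by (simp add: gx_def gy_def)
  have \<phi>g: "GDERIV (\<lambda>x. \<phi> x i) xb :> \<phi>' i" if "i < p1 + p2" for i
    unfolding \<phi>'_def by (rule \<phi>'0[OF that])
  have \<psi>g: "GDERIV (\<lambda>z. \<psi> z i) (xb, yb) :> (ax i, ay i)" if "i < q1 + q2" for i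
    using \<psi>'(1)[OF that] by (simp add: ax_def ay_def)
  have xb: "xb \<in> X" and yb: "yb \<in> feasible_y \<psi> q1 q2 xb"
    using minimax unfolding calm_local_minimax_def Y_eq by auto
  obtain d where d: "0 < d" and max: "\<And>y. y \<in> Y xb \<Longrightarrow> y \<in> cball yb d \<Longrightarrow> f (xb, y) \<le> f (xb, yb)"
  proof -
    obtain \<delta>0 where \<delta>0: "0 < \<delta>0" and mm: "\<forall>\<delta>\<in>{0<..\<delta>0}. \<forall>x\<in>X \<inter> cball xb \<delta>. \<forall>y\<in>Y xb \<inter> cball yb \<delta>.
        f (xb, y) \<le> f (xb, yb)"
      using minimax unfolding calm_local_minimax_def by blast
    show thesis
      using that[OF \<delta>0] mm[rule_format, of \<delta>0 xb] \<delta>0 xb by auto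
  qed
  have "MFCQ \<psi> q1 q2 xb yb \<or> RCRCQ \<psi> q1 q2 xb yb"
    using cq by (metis RCRCQ_if_affine)
  then have "\<exists>\<beta>. (\<forall>i\<in>A0. 0 \<le> \<beta> i) \<and> gy = (\<Sum>i\<in>A0 \<union> E. \<beta> i *\<^sub>R ay i)"
    unfolding A0_def E_def gy_def ay_def
    using max unfolding Y_eq by (intro lower_level_KKT[OF f' \<psi>' yb d]) auto
  then obtain \<beta>0 where \<beta>0: "\<forall>i\<in>A0. 0 \<le> \<beta>0 i" "gy = (\<Sum>i\<in>A0 \<union> E. \<beta>0 i *\<^sub>R ay i)" by blast
  define g where "g = gx - (\<Sum>i\<in>A0 \<union> E. \<beta>0 i *\<^sub>R ax i)"
  \<comment> \<open>The gradient in \<open>x\<close> of the Lagrangian with \<open>\<alpha> = 0\<close> is \<open>g\<close>. It is nonnegative on the linearized cone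
    by weak duality: pair the linearized constraints on \<open>(u, v)\<close> with the multipliers \<open>\<beta>0\<close> and
    eliminate \<open>v\<close> through the stationarity in \<open>y\<close>.\<close>
  have ascent: "0 \<le> u \<bullet> g" if u: "\<forall>i\<in>P0. u \<bullet> \<phi>' i \<le> 0" "\<forall>i\<in>F. u \<bullet> \<phi>' i = 0" for u
  proof -
    define t :: "nat \<Rightarrow> real" where "t = (\<lambda>k. inverse (real (Suc k)))"
    have t: "t \<longlonglongrightarrow> 0" "\<And>k. 0 < t k"
      unfolding t_def by (rule LIMSEQ_inverse_real_of_nat) simp
    have "\<exists>x. (\<forall>k. x k \<in> feasible_x \<phi> p1 p2) \<and> (\<lambda>k. (x k - xb) /\<^sub>R t k) \<longlonglongrightarrow> u"
    proof (rule MSCQ_tangent_sequence[OF mscq _ \<phi>g _ _ _ t])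
      show "continuous_on UNIV (\<lambda>x. \<phi> x i)" if "i < p1 + p2" for i
        using \<phi>'0[OF that] unfolding gderiv_def
        by (intro continuous_at_imp_continuous_on ballI) (rule has_derivative_continuous)
    qed (use xb X_eq u in \<open>auto simp: P0_def F_def\<close>)
    then obtain x where x: "\<And>k. x k \<in> X" "(\<lambda>k. (x k - xb) /\<^sub>R t k) \<longlonglongrightarrow> u"
      unfolding X_eq by blast
    obtain v where v: "0 \<le> u \<bullet> gx + v \<bullet> gy"
      "\<And>i. i \<in> A0 \<Longrightarrow> u \<bullet> ax i + v \<bullet> ay i \<le> 0" "\<And>i. i \<in> E \<Longrightarrow> u \<bullet> ax i + v \<bullet> ay i = 0"
      using calm_minimax_ascent_direction[OF minimax[unfolded Y_eq] fg \<psi>g x t]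
      unfolding A0_iff E_def by blast
    have "(\<Sum>i\<in>A0 \<union> E. \<beta>0 i * (u \<bullet> ax i + v \<bullet> ay i)) \<le> 0"
      using v(2,3) \<beta>0(1) by (intro sum_nonpos) (auto intro: mult_nonneg_nonpos)
    moreover have "v \<bullet> gy = (\<Sum>i\<in>A0 \<union> E. \<beta>0 i * (v \<bullet> ay i))"
      unfolding \<beta>0(2) by (simp add: inner_sum_right)
    moreover have "u \<bullet> g = u \<bullet> gx - (\<Sum>i\<in>A0 \<union> E. \<beta>0 i * (u \<bullet> ax i))"
      by (simp add: g_def inner_diff_right inner_sum_right)
    ultimately show "0 \<le> u \<bullet> g"
      using v(1) by (simp add: distrib_left sum.distrib)
  qed
  have "\<exists>\<alpha>. (\<forall>i\<in>P0. 0 \<le> \<alpha> i) \<and> - g = (\<Sum>i\<in>P0 \<union> F. \<alpha> i *\<^sub>R \<phi>' i)"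
    by (rule Farkas[OF fin(3,4) disj]) (use ascent in auto)
  then obtain \<alpha>0 where \<alpha>0: "\<forall>i\<in>P0. 0 \<le> \<alpha>0 i" "- g = (\<Sum>i\<in>P0 \<union> F. \<alpha>0 i *\<^sub>R \<phi>' i)" by blast
  define \<alpha> where "\<alpha> = (\<lambda>i. if i \<in> P0 \<union> F then \<alpha>0 i else 0)"
  define \<beta> where "\<beta> = (\<lambda>i. if i \<in> A0 \<union> E then \<beta>0 i else 0)"
  have \<alpha>_sum: "(\<Sum>i<p1 + p2. \<alpha> i *\<^sub>R w i) = (\<Sum>i\<in>P0 \<union> F. \<alpha>0 i *\<^sub>R w i)" for w :: "nat \<Rightarrow> real ^ 'n"
    using sub by (intro sum.mono_neutral_cong_right) (auto simp: \<alpha>_def)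
  have ax_sum: "(\<Sum>i<q1 + q2. \<beta> i *\<^sub>R ax i) = (\<Sum>i\<in>A0 \<union> E. \<beta>0 i *\<^sub>R ax i)"
    and ay_sum: "(\<Sum>i<q1 + q2. \<beta> i *\<^sub>R ay i) = (\<Sum>i\<in>A0 \<union> E. \<beta>0 i *\<^sub>R ay i)"
    by (rule sum.mono_neutral_cong_right, use sub in \<open>auto simp: \<beta>_def\<close>)+
  show ?thesis
  proof (intro exI conjI)
    show "\<forall>i<p1. 0 \<le> \<alpha> i" using \<alpha>0(1) by (auto simp: \<alpha>_def F_def)
    show "\<forall>i<q1. 0 \<le> \<beta> i" using \<beta>0(1) by (auto simp: \<beta>_def E_def)
    show "(\<Sum>i<p1. \<alpha> i * \<phi> xb i) = 0"
      by (rule sum.neutral) (auto simp: \<alpha>_def P0_def F_def)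
    show "(\<Sum>i<q1. \<beta> i * \<psi> (xb, yb) i) = 0"
      by (rule sum.neutral) (auto simp: \<beta>_def A0_iff E_def)
    have x_zero: "gx + (\<Sum>i<p1 + p2. \<alpha> i *\<^sub>R \<phi>' i) - (\<Sum>i<q1 + q2. \<beta> i *\<^sub>R ax i) = 0"
      unfolding \<alpha>_sum ax_sum \<alpha>0(2)[symmetric] by (simp add: g_def)
    have y_zero: "gy - (\<Sum>i<q1 + q2. \<beta> i *\<^sub>R ay i) = 0"
      unfolding ay_sum using \<beta>0(2) by simp
    have "GDERIV (\<lambda>(x, y). lagrangian f \<phi> (p1 + p2) \<psi> (q1 + q2) x y \<alpha> \<beta>) (xb, yb) :>
        (gx + (\<Sum>i<p1 + p2. \<alpha> i *\<^sub>R \<phi>' i) - (\<Sum>i<q1 + q2. \<beta> i *\<^sub>R ax i),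
         gy - (\<Sum>i<q1 + q2. \<beta> i *\<^sub>R ay i))"
      by (rule GDERIV_lagrangian[OF fg \<phi>g \<psi>g])
    then show "GDERIV (\<lambda>(x, y). lagrangian f \<phi> (p1 + p2) \<psi> (q1 + q2) x y \<alpha> \<beta>) (xb, yb) :> 0"
      unfolding x_zero y_zero by (simp add: zero_prod_def)
  qed
qed

end
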